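(* Let $\alpha\ge 1/2$, let $\delta_1\ge\delta_2\ge\cdots$ be the eigenvalues of the operator $\mathcal{S}$ defined in the context, and let $\rho_k=\alpha^\alpha b_\alpha^{4k+2\alpha}$, $k\ge0$. Then for all $k\ge1$, $\rho_{k-1}\ge\delta_k\ge\rho_{k+1}$. In particular, $\delta_k=O(\rho_k)$ as $k\to\infty$.
   Context: $P_0$ is the $Gamma(\alpha,1)$ distribution, with density $x^{\alpha-1}e^{-x}/\Gamma(\alpha)$ on $(0,\infty)$, and $L^2=L^2(P_0)$ is the Hilbert space of Borel functions $f:[0,\infty)\to\mathbb{C}$ square-integrable with respect to $P_0$. With $I_\nu(x)=\sum_{j\ge0}\frac{1}{j!\,\Gamma(\nu+1+j)}(x/2)^{2j+\nu}$, define for $s,t\ge0$ $$K(s,t)=e^{-(s+t)/\alpha}\Big[\Gamma(\alpha)(st/\alpha^2)^{(1-\alpha)/2}I_{\alpha-1}\big(2\sqrt{st}/\alpha\big)-\alpha^{-3}st-1\Big]$$ (the expression $x^{(1-\alpha)/2}I_{\alpha-1}(2\sqrt x)$ is a power series in $x$, equal to $1/\Gamma(\alpha)$ at $x=0$), and $\mathcal{S}f(s)=\int_0^\infty K(s,t)f(t)\,dP_0(t)$ for $f\in L^2$. Its positive eigenvalues are listed in non-increasing order as $\{\delta_k:k\ge1\}$. Further, $\beta=((\alpha+4)/\alpha)^{1/2}$ and $b_\alpha=(1+\tfrac12\alpha(1-\beta))^{1/2}$. (The numbers $\rho_k$, $k\ge0$, are the eigenvalues of the integral operator $\mathcal{S}_0$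 on $L^2$ whose kernel is $K_0(s,t)=K(s,t)+e^{-(s+t)/\alpha}(\alpha^{-3}st+1)$.) *)

theory Defs
  imports "HOL-Analysis.Analysis" "HOL-Library.Landau_Symbols"
begin

section \<open>Integral operators on complex \<open>L\<^sup>2\<close> spaces\<close>

text \<open>Elements of \<open>L\<^sup>2(M)\<close> are represented by functions; functions that agree almost
  everywhere represent the same element, so every equation between elements below is an
  almost-everywhere equation.\<close>

definition L2_functions :: "'a measure \<Rightarrow> ('a \<Rightarrow> complex) set" where
  "L2_functions M = {f \<in> borel_measurable M. integrable M (\<lambda>x. (cmod (f x))\<^sup>2)}"

definition integral_operator ::
    "'a measure \<Rightarrow> ('a \<Rightarrow> 'a \<Rightarrow> real) \<Rightarrow> ('a \<Rightarrow> complex) \<Rightarrow> 'a \<Rightarrow> complex" where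
  "integral_operator M K f = (\<lambda>s. LINT t|M. complex_of_real (K s t) * f t)"

definition eigenspace ::
    "'a measure \<Rightarrow> (('a \<Rightarrow> complex) \<Rightarrow> 'a \<Rightarrow> complex) \<Rightarrow> real \<Rightarrow> ('a \<Rightarrow> complex) set" where
  "eigenspace M T \<mu> =
     {f \<in> L2_functions M. AE s in M. T f s = complex_of_real \<mu> * f s}"

text \<open>The vector space that the set \<open>V\<close> of functions represents modulo almost-everywhere equality
  has a basis of \<open>n\<close> elements, that is, its complex dimension is \<open>n\<close>.\<close>

definition has_dim_mod_AE :: "'a measure \<Rightarrow> ('a \<Rightarrow> complex) set \<Rightarrow> nat \<Rightarrow> bool" where
  "has_dim_mod_AE M V n \<longleftrightarrow>
     (\<exists>b :: nat \<Rightarrow> 'a \<Rightarrow> complex.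
        (\<forall>i<n. b i \<in> V) \<and>
        (\<forall>c :: nat \<Rightarrow> complex. (AE x in M. (\<Sum>i<n. c i * b i x) = 0) \<longrightarrow> (\<forall>i<n. c i = 0)) \<and>
        (\<forall>f\<in>V. \<exists>c :: nat \<Rightarrow> complex. AE x in M. f x = (\<Sum>i<n. c i * b i x)))"

text \<open>\<open>\<delta> 1, \<delta> 2, \<dots>\<close> lists the positive eigenvalues of \<open>T\<close> in non-increasing order, each repeated
  according to its multiplicity (the value \<open>\<delta> 0\<close> is not used). That there are infinitely many
  positive eigenvalues is not presupposed: were there finitely many, the list would be continued
  by zeros. A positive number that is not an eigenvalue has an eigenspace of dimension 0 and
  hence does not occur in the list.\<close>

definition lists_positive_eigenvalues ::
    "'a measure \<Rightarrow> (('a \<Rightarrow> complex) \<Rightarrow> 'a \<Rightarrow> complex) \<Rightarrow> (nat \<Rightarrow> real) \<Rightarrow> bool" where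
  "lists_positive_eigenvalues M T \<delta> \<longleftrightarrow>
     (\<forall>k\<ge>1. \<delta> k \<ge> 0) \<and>
     (\<forall>j k. 1 \<le> j \<and> j \<le> k \<longrightarrow> \<delta> k \<le> \<delta> j) \<and>
     (\<forall>\<mu>>0. finite {k. k \<ge> 1 \<and> \<delta> k = \<mu>} \<and>
             has_dim_mod_AE M (eigenspace M T \<mu>) (card {k. k \<ge> 1 \<and> \<delta> k = \<mu>}))"


section \<open>The operator \<open>\<S>\<close>\<close>

text \<open>The distribution lives on \<open>(0,\<infinity>)\<close>; it is realised as a measure on the real line for which
  the non-positive half-line is a null set, so values of functions there are immaterial.\<close>

definition gamma_distr :: "real \<Rightarrow> real measure" where
  "gamma_distr \<alpha> = density lborel
     (\<lambda>x. ennreal (if x > 0 then x powr (\<alpha> - 1) * exp (- x) / Gamma \<alpha> else 0))"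

definition bessel_I :: "real \<Rightarrow> real \<Rightarrow> real" where
  "bessel_I \<nu> x = (\<Sum>j. 1 / (fact j * Gamma (\<nu> + 1 + real j)) * (x / 2) powr (2 * real j + \<nu>))"

text \<open>The function \<open>x\<^bsup>(1-\<alpha>)/2\<^esup> I\<^bsub>\<alpha>-1\<^esub>(2 \<surd>x)\<close> for \<open>x \<ge> 0\<close>, with its limit value at \<open>x = 0\<close>
  (where \<open>powr\<close> would give 0).\<close>

definition bessel_factor :: "real \<Rightarrow> real \<Rightarrow> real" where
  "bessel_factor \<alpha> x =
     (if x = 0 then 1 / Gamma \<alpha> else x powr ((1 - \<alpha>) / 2) * bessel_I (\<alpha> - 1) (2 * sqrt x))"

text \<open>For \<open>s, t \<ge> 0\<close> and \<open>\<alpha> > 0\<close> one has \<open>2 \<surd>(s t / \<alpha>\<^sup>2) = 2 \<surd>(s t) / \<alpha>\<close>, the argument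
  of the Bessel function in the kernel.\<close>

definition kernel_K :: "real \<Rightarrow> real \<Rightarrow> real \<Rightarrow> real" where
  "kernel_K \<alpha> s t =
     exp (- (s + t) / \<alpha>) * (Gamma \<alpha> * bessel_factor \<alpha> (s * t / \<alpha>\<^sup>2) - s * t / \<alpha> ^ 3 - 1)"

definition operator_S :: "real \<Rightarrow> (real \<Rightarrow> complex) \<Rightarrow> real \<Rightarrow> complex" where
  "operator_S \<alpha> = integral_operator (gamma_distr \<alpha>) (kernel_K \<alpha>)"

definition beta_of :: "real \<Rightarrow> real" where
  "beta_of \<alpha> = sqrt ((\<alpha> + 4) / \<alpha>)"

definition b_of :: "real \<Rightarrow> real" where
  "b_of \<alpha> = sqrt (1 + \<alpha> * (1 - beta_of \<alpha>) / 2)"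

definition rho :: "real \<Rightarrow> nat \<Rightarrow> real" where
  "rho \<alpha> k = \<alpha> powr \<alpha> * b_of \<alpha> powr (4 * real k + 2 * \<alpha>)"

end

theory Submission
  imports Defs "HOL-Library.Diagonal_Subsequence" "HOL-Computational_Algebra.Polynomial"
begin

text \<open>Expanding the Bessel function gives \<open>K\<^sub>0(s,t) = \<Sum>\<^sub>j g\<^sub>j(s) g\<^sub>j(t)\<close> with features
\<open>g\<^sub>j(s) = \<surd>(\<Gamma>(\<alpha>) / (j! \<Gamma>(\<alpha>+j))) (s/\<alpha>)\<^sup>j e\<^bsup>-s/\<alpha>\<^esup>\<close>, and the two terms subtracted in the kernel \<open>K\<close> are
exactly those with \<open>j = 0\<close> and \<open>j = 1\<close>. Hence \<open>\<S>\<close> and \<open>\<S>\<^sub>0\<close> are positive operators and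
\<open>\<S>\<^sub>0 - \<S>\<close> is positive of rank at most two. The theorem is the interlacing of eigenvalues under such a
perturbation, together with the eigenvalues of \<open>\<S>\<^sub>0\<close>.

For the interlacing (\<open>eigenvalue_le\<close>, \<open>eigenvalue_ge\<close>), only two dimension counts are used. If \<open>\<delta>\<^sub>k\<close>
exceeded \<open>\<rho>\<^bsub>k-1\<^esub>\<close>, the span of \<open>k\<close> eigenfunctions of \<open>\<S>\<close> would contain a nonzero \<open>f\<close> orthogonal to the
first \<open>k-1\<close> eigenfunctions of \<open>\<S>\<^sub>0\<close>, and on such \<open>f\<close> the form of \<open>\<S>\<^sub>0\<close>, hence that of \<open>\<S>\<close>, is at
most \<open>\<rho>\<^bsub>k-1\<^esub>\<close> times the squared norm. If \<open>\<delta>\<^sub>k\<close> were below \<open>\<rho>\<^bsub>k+1\<^esub>\<close>, the span of the first \<open>k+2\<close>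
eigenfunctions of \<open>\<S>\<^sub>0\<close> would contain a nonzero \<open>f\<close> orthogonal to \<open>g\<^sub>0\<close>, \<open>g\<^sub>1\<close> and to every eigenfunction
of \<open>\<S>\<close> whose eigenvalue is at least \<open>\<rho>\<^bsub>k+1\<^esub>\<close>; maximising the form of \<open>\<S>\<close> on the orthogonal complement
of the latter produces one more such eigenfunction, a contradiction.
That the maximum is attained is the compactness of the operator (\<open>exists_eigenvector_orthogonal\<close>).

The eigenfunctions of \<open>\<S>\<^sub>0\<close> are exponential polynomials. If \<open>c\<close> is the positive root of
\<open>c\<^sup>2 + c = 1/\<alpha>\<close>, then \<open>\<S>\<^sub>0\<close> maps \<open>e\<^bsup>-cs\<^esup> s\<^sup>n\<close> to \<open>e\<^bsup>-cs\<^esup>\<close> times a polynomial of degree \<open>n\<close> with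
leading coefficient \<open>\<rho>\<^sub>n\<close> (\<open>T_E_monom\<close>). A triangular operator with distinct diagonal entries is
diagonalisable, which gives an eigenfunction for each \<open>\<rho>\<^sub>n\<close>. A further eigenfunction would be orthogonal to
all \<open>e\<^bsup>-cs\<^esup> s\<^sup>n\<close>, hence, by the Taylor expansion of \<open>e\<^bsup>-(1/\<alpha>-c)s\<^esup>\<close>, to all features, and its eigenvalue
would be \<open>0\<close>. The expansion may be integrated term by term because \<open>\<alpha> \<ge> 1/2\<close> (\<open>c_large\<close>).\<close>

section \<open>The semi-inner product on square-integrable functions\<close>

lemma borel_measurable_cnj [measurable]:
  assumes "f \<in> borel_measurable M"
  shows "(\<lambda>x. cnj (f x)) \<in> borel_measurable M"
  using measurable_compose[OF assms borel_measurable_continuous_onI[OF continuous_on_cnj[OF continuous_on_id]]] .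

definition l2_inner :: "'a measure \<Rightarrow> ('a \<Rightarrow> complex) \<Rightarrow> ('a \<Rightarrow> complex) \<Rightarrow> complex" where
  "l2_inner M f g = (LINT x|M. f x * cnj (g x))"

definition l2_normsq :: "'a measure \<Rightarrow> ('a \<Rightarrow> complex) \<Rightarrow> real" where
  "l2_normsq M f = (LINT x|M. (cmod (f x))\<^sup>2)"

lemma L2_functionsD:
  assumes "f \<in> L2_functions M"
  shows "f \<in> borel_measurable M" "integrable M (\<lambda>x. (cmod (f x))\<^sup>2)"
  using assms by (auto simp: L2_functions_def)

lemma cmod_mult_le_sum_squares: "cmod (a * cnj b) \<le> (cmod a)\<^sup>2 + (cmod b)\<^sup>2"
proof -
  have "0 \<le> (cmod a - cmod b)\<^sup>2" "0 \<le> (cmod a)\<^sup>2 + (cmod b)\<^sup>2" by simp_all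
  thus ?thesis unfolding power2_diff norm_mult complex_mod_cnj by linarith
qed

lemma cmod_add_squared_le: "(cmod (a + b))\<^sup>2 \<le> 2 * (cmod a)\<^sup>2 + 2 * (cmod b)\<^sup>2"
proof -
  have "(cmod (a + b))\<^sup>2 \<le> (cmod a + cmod b)\<^sup>2"
    by (intro power_mono norm_triangle_ineq) simp
  also have "\<dots> \<le> 2 * (cmod a)\<^sup>2 + 2 * (cmod b)\<^sup>2"
    using zero_le_power2[of "cmod a - cmod b"] by (simp add: power2_diff power2_sum)
  finally show ?thesis .
qed

lemma L2_inner_integrable:
  assumes f: "f \<in> L2_functions M" and g: "g \<in> L2_functions M"
  shows "integrable M (\<lambda>x. f x * cnj (g x))"
proof (rule Bochner_Integration.integrable_bound)
  note [measurable] = L2_functionsD(1)[OF f] L2_functionsD(1)[OF g]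
  show "integrable M (\<lambda>x. (cmod (f x))\<^sup>2 + (cmod (g x))\<^sup>2)"
    using f g by (simp add: L2_functions_def)
  show "(\<lambda>x. f x * cnj (g x)) \<in> borel_measurable M" by measurable
  show "AE x in M. norm (f x * cnj (g x)) \<le> norm ((cmod (f x))\<^sup>2 + (cmod (g x))\<^sup>2)"
    using cmod_mult_le_sum_squares by (intro AE_I2) (simp del: complex_mod_cnj)
qed

lemma L2_zero: "(\<lambda>_. 0) \<in> L2_functions M"
  by (simp add: L2_functions_def)

lemma L2_scale:
  assumes "f \<in> L2_functions M"
  shows "(\<lambda>x. c * f x) \<in> L2_functions M"
  using assms by (auto simp: L2_functions_def norm_mult power_mult_distrib)

lemma L2_add:
  assumes f: "f \<in> L2_functions M" and g: "g \<in> L2_functions M"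
  shows "(\<lambda>x. f x + g x) \<in> L2_functions M"
proof -
  note [measurable] = L2_functionsD(1)[OF f] L2_functionsD(1)[OF g]
  have "integrable M (\<lambda>x. (cmod (f x + g x))\<^sup>2)"
  proof (rule Bochner_Integration.integrable_bound)
    show "integrable M (\<lambda>x. 2 * (cmod (f x))\<^sup>2 + 2 * (cmod (g x))\<^sup>2)"
      using f g by (simp add: L2_functions_def)
    show "AE x in M. norm ((cmod (f x + g x))\<^sup>2) \<le> norm (2 * (cmod (f x))\<^sup>2 + 2 * (cmod (g x))\<^sup>2)"
      using cmod_add_squared_le by (intro AE_I2) simp
  qed measurable
  thus ?thesis by (simp add: L2_functions_def)
qed

lemma L2_diff:
  assumes "f \<in> L2_functions M" "g \<in> L2_functions M"
  shows "(\<lambda>x. f x - g x) \<in> L2_functions M"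
  using L2_add[OF assms(1) L2_scale[OF assms(2), of "-1"]] by simp

lemma L2_sum:
  assumes "\<And>i. i \<in> I \<Longrightarrow> f i \<in> L2_functions M"
  shows "(\<lambda>x. \<Sum>i\<in>I. c i * f i x) \<in> L2_functions M"
  using assms by (induction I rule: infinite_finite_induct) (auto intro!: L2_zero L2_add L2_scale)

lemma l2_inner_cong_AE:
  assumes "AE x in M. f x = f' x" "AE x in M. g x = g' x"
    and "f \<in> borel_measurable M" "f' \<in> borel_measurable M"
        "g \<in> borel_measurable M" "g' \<in> borel_measurable M"
  shows "l2_inner M f g = l2_inner M f' g'"
proof -
  note [measurable] = assms(3-6)
  show ?thesis unfolding l2_inner_def
    by (rule integral_cong_AE) (use assms(1,2) in auto)
qed

lemma l2_inner_add_left: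
  assumes "f \<in> L2_functions M" "g \<in> L2_functions M" "h \<in> L2_functions M"
  shows "l2_inner M (\<lambda>x. f x + g x) h = l2_inner M f h + l2_inner M g h"
  unfolding l2_inner_def distrib_right
  by (rule Bochner_Integration.integral_add) (intro L2_inner_integrable assms)+

lemma l2_inner_diff_left:
  assumes "f \<in> L2_functions M" "g \<in> L2_functions M" "h \<in> L2_functions M"
  shows "l2_inner M (\<lambda>x. f x - g x) h = l2_inner M f h - l2_inner M g h"
  unfolding l2_inner_def left_diff_distrib
  by (rule Bochner_Integration.integral_diff) (intro L2_inner_integrable assms)+

lemma l2_inner_scale_left: "l2_inner M (\<lambda>x. c * f x) h = c * l2_inner M f h"
  by (simp add: l2_inner_def mult.assoc)

lemma l2_inner_cnj: "cnj (l2_inner M f g) = l2_inner M g f"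
  using Bochner_Integration.integral_cnj[of M "\<lambda>x. f x * cnj (g x)"] by (simp add: l2_inner_def mult.commute)

lemma l2_inner_scale_right: "l2_inner M f (\<lambda>x. c * h x) = cnj c * l2_inner M f h"
  using arg_cong[OF l2_inner_scale_left[of M c h f], of cnj] by (simp only: complex_cnj_mult l2_inner_cnj)

lemma l2_inner_diff_right:
  assumes "f \<in> L2_functions M" "g \<in> L2_functions M" "h \<in> L2_functions M"
  shows "l2_inner M h (\<lambda>x. f x - g x) = l2_inner M h f - l2_inner M h g"
  using arg_cong[OF l2_inner_diff_left[OF assms], of cnj] by (simp only: complex_cnj_diff l2_inner_cnj)

lemma l2_inner_sum_left:
  assumes "\<And>i. i \<in> I \<Longrightarrow> f i \<in> L2_functions M" "h \<in> L2_functions M"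
  shows "l2_inner M (\<lambda>x. \<Sum>i\<in>I. c i * f i x) h = (\<Sum>i\<in>I. c i * l2_inner M (f i) h)"
  using assms
proof (induction I rule: infinite_finite_induct)
  case (insert i I)
  thus ?case
    by (simp add: l2_inner_add_left L2_scale L2_sum l2_inner_scale_left)
qed (simp_all add: l2_inner_def)

lemma l2_inner_sum_right:
  assumes "\<And>i. i \<in> I \<Longrightarrow> f i \<in> L2_functions M" "h \<in> L2_functions M"
  shows "l2_inner M h (\<lambda>x. \<Sum>i\<in>I. c i * f i x) = (\<Sum>i\<in>I. cnj (c i) * l2_inner M h (f i))"
proof -
  have "l2_inner M h (\<lambda>x. \<Sum>i\<in>I. c i * f i x) = cnj (\<Sum>i\<in>I. c i * l2_inner M (f i) h)"
    by (subst l2_inner_sum_left[OF assms, symmetric]) (simp_all only: l2_inner_cnj)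
  thus ?thesis by (simp add: l2_inner_cnj)
qed

lemma l2_inner_self: "l2_inner M f f = of_real (l2_normsq M f)"
proof -
  have "(\<lambda>x. f x * cnj (f x)) = (\<lambda>x. complex_of_real ((cmod (f x))\<^sup>2))"
    by (simp add: complex_norm_square[symmetric])
  thus ?thesis
    unfolding l2_inner_def l2_normsq_def by (simp only: integral_complex_of_real)
qed

lemma l2_normsq_nonneg: "0 \<le> l2_normsq M f"
  by (simp add: l2_normsq_def)

lemma l2_normsq_scale: "l2_normsq M (\<lambda>x. c * f x) = (cmod c)\<^sup>2 * l2_normsq M f"
  by (simp add: l2_normsq_def norm_mult power_mult_distrib)

lemma l2_normsq_eq_0_iff:
  assumes "f \<in> L2_functions M"
  shows "l2_normsq M f = 0 \<longleftrightarrow> (AE x in M. f x = 0)"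
  using integral_nonneg_eq_0_iff_AE[OF L2_functionsD(2)[OF assms]] by (simp add: l2_normsq_def)

lemma l2_normsq_diff:
  assumes "f \<in> L2_functions M" "g \<in> L2_functions M"
  shows "l2_normsq M (\<lambda>x. f x - g x) = l2_normsq M f + l2_normsq M g - 2 * Re (l2_inner M f g)"
proof -
  have "complex_of_real (l2_normsq M (\<lambda>x. f x - g x)) =
      of_real (l2_normsq M f) + of_real (l2_normsq M g) - (l2_inner M f g + cnj (l2_inner M f g))"
    unfolding l2_inner_self[symmetric] l2_inner_cnj
    unfolding l2_inner_diff_left[OF assms L2_diff[OF assms]] l2_inner_diff_right[OF assms assms(1)]
      l2_inner_diff_right[OF assms assms(2)] by simp
  thus ?thesis by (simp add: complex_eq_iff)
qed

lemma l2_normsq_add_le: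
  assumes "f \<in> L2_functions M" "g \<in> L2_functions M"
  shows "l2_normsq M (\<lambda>x. f x + g x) \<le> 2 * l2_normsq M f + 2 * l2_normsq M g"
proof -
  have "l2_normsq M (\<lambda>x. f x + g x) \<le> (LINT x|M. 2 * (cmod (f x))\<^sup>2 + 2 * (cmod (g x))\<^sup>2)"
    unfolding l2_normsq_def using cmod_add_squared_le L2_functionsD(2)[OF L2_add[OF assms]] assms
    by (intro integral_mono) (auto simp: L2_functions_def)
  thus ?thesis using assms by (simp add: l2_normsq_def L2_functions_def)
qed

lemma l2_inner_eq_0_if_AE_0:
  assumes "AE x in M. f x = 0"
  shows "l2_inner M f g = 0"
  unfolding l2_inner_def by (rule integral_eq_zero_AE) (use assms in auto)

lemma l2_cauchy_schwarz:
  assumes f: "f \<in> L2_functions M" and g: "g \<in> L2_functions M"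
  shows "(cmod (l2_inner M f g))\<^sup>2 \<le> l2_normsq M f * l2_normsq M g"
proof (cases "l2_normsq M g = 0")
  case True
  hence "l2_inner M g f = 0"
    using l2_normsq_eq_0_iff[OF g] l2_inner_eq_0_if_AE_0 by blast
  hence "l2_inner M f g = 0"
    using l2_inner_cnj[of M g f] by simp
  thus ?thesis using True by simp
next
  case False
  define F G z where "F = l2_normsq M f" and "G = l2_normsq M g" and "z = l2_inner M f g"
  have G: "G > 0" using False l2_normsq_nonneg[of M g] by (simp add: G_def)
  have "0 \<le> l2_normsq M (\<lambda>x. complex_of_real G * f x - z * g x)"
    by (rule l2_normsq_nonneg)
  also have "\<dots> = G\<^sup>2 * F + (cmod z)\<^sup>2 * G - 2 * Re (G * (cnj z * z))"
    using f g by (simp add: l2_normsq_diff L2_scale l2_normsq_scale l2_inner_scale_left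
        l2_inner_scale_right F_def G_def z_def)
  also have "Re (G * (cnj z * z)) = G * (cmod z)\<^sup>2"
    by (simp add: cmod_power2 power2_eq_square[of "Re z"] power2_eq_square[of "Im z"])
  finally have "0 \<le> G * (F * G - (cmod z)\<^sup>2)"
    by (simp add: algebra_simps power2_eq_square)
  thus ?thesis using G by (simp add: zero_le_mult_iff F_def G_def z_def)
qed

section \<open>Positive operators given by a summable family of features\<close>

lemma cauchy_schwarz_suminf:
  fixes a b :: "nat \<Rightarrow> real"
  assumes a: "summable (\<lambda>j. (a j)\<^sup>2)" and b: "summable (\<lambda>j. (b j)\<^sup>2)" and ab: "summable (\<lambda>j. a j * b j)"
  shows "(\<Sum>j. a j * b j)\<^sup>2 \<le> (\<Sum>j. (a j)\<^sup>2) * (\<Sum>j. (b j)\<^sup>2)"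
proof (rule LIMSEQ_le)
  show "(\<lambda>n. (\<Sum>j<n. a j * b j)\<^sup>2) \<longlonglongrightarrow> (\<Sum>j. a j * b j)\<^sup>2"
    by (intro tendsto_power summable_LIMSEQ ab)
  show "(\<lambda>n. (\<Sum>j<n. (a j)\<^sup>2) * (\<Sum>j<n. (b j)\<^sup>2)) \<longlonglongrightarrow> (\<Sum>j. (a j)\<^sup>2) * (\<Sum>j. (b j)\<^sup>2)"
    by (intro tendsto_mult summable_LIMSEQ a b)
  show "\<exists>N. \<forall>n\<ge>N. (\<Sum>j<n. a j * b j)\<^sup>2 \<le> (\<Sum>j<n. (a j)\<^sup>2) * (\<Sum>j<n. (b j)\<^sup>2)"
    using Cauchy_Schwarz_ineq_sum by blast
qed

text \<open>A family of features \<open>g\<^sub>j\<close> with finite total squared norm defines a Hilbert-Schmidt map \<open>G\<close> from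
square-summable sequences to functions (\<open>synth\<close>), with adjoint \<open>G\<^sup>*\<close> (\<open>coef\<close>). The operator \<open>T = G G\<^sup>*\<close> has kernel
\<open>\<Sum>\<^sub>j g\<^sub>j(s) cnj (g\<^sub>j(t))\<close> and quadratic form \<open>Q\<close>. Square-summability at every single point makes
\<open>synth\<close> a pointwise defined function, so that limits can be taken pointwise under an integrable majorant.\<close>

locale summable_features =
  fixes M :: "'a measure" and g :: "nat \<Rightarrow> 'a \<Rightarrow> complex"
  assumes feature_L2: "g j \<in> L2_functions M"
    and summable_trace: "summable (\<lambda>j. l2_normsq M (g j))"
    and summable_pointwise: "summable (\<lambda>j. (cmod (g j x))\<^sup>2)"
begin

definition synth :: "(nat \<Rightarrow> complex) \<Rightarrow> 'a \<Rightarrow> complex" where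
  "synth a x = (\<Sum>j. a j * g j x)"

definition coef :: "('a \<Rightarrow> complex) \<Rightarrow> nat \<Rightarrow> complex" where
  "coef f j = l2_inner M f (g j)"

definition T :: "('a \<Rightarrow> complex) \<Rightarrow> 'a \<Rightarrow> complex" where
  "T f = synth (coef f)"

definition Q :: "('a \<Rightarrow> complex) \<Rightarrow> real" where
  "Q f = (\<Sum>j. (cmod (coef f j))\<^sup>2)"

definition trace :: real where
  "trace = (\<Sum>j. l2_normsq M (g j))"

definition diag :: "'a \<Rightarrow> real" where
  "diag x = (\<Sum>j. (cmod (g j x))\<^sup>2)"

lemma diag_nonneg: "0 \<le> diag x"
  unfolding diag_def by (intro suminf_nonneg summable_pointwise) simp

lemma coef_bound:
  assumes "f \<in> L2_functions M"
  shows "(cmod (coef f j))\<^sup>2 \<le> l2_normsq M f * l2_normsq M (g j)"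
  unfolding coef_def by (rule l2_cauchy_schwarz[OF assms feature_L2])

lemma summable_coef:
  assumes "f \<in> L2_functions M"
  shows "summable (\<lambda>j. (cmod (coef f j))\<^sup>2)"
  by (rule summable_comparison_test'[OF summable_mult[OF summable_trace, of "l2_normsq M f"]])
     (use coef_bound[OF assms] in auto)

lemma Q_nonneg: "f \<in> L2_functions M \<Longrightarrow> 0 \<le> Q f"
  unfolding Q_def by (intro suminf_nonneg summable_coef) auto

lemma Q_le_trace:
  assumes "f \<in> L2_functions M"
  shows "Q f \<le> l2_normsq M f * trace"
  unfolding Q_def trace_def suminf_mult[OF summable_trace, symmetric]
  by (intro suminf_le coef_bound summable_coef summable_mult summable_trace assms)

lemma coef_diff:
  assumes "f \<in> L2_functions M" "h \<in> L2_functions M"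
  shows "coef (\<lambda>x. f x - h x) j = coef f j - coef h j"
  unfolding coef_def by (rule l2_inner_diff_left[OF assms feature_L2])

lemma coef_scale: "coef (\<lambda>x. c * f x) j = c * coef f j"
  unfolding coef_def by (rule l2_inner_scale_left)

lemma Q_scale: "f \<in> L2_functions M \<Longrightarrow> Q (\<lambda>x. c * f x) = (cmod c)\<^sup>2 * Q f"
  by (simp add: Q_def coef_scale norm_mult power_mult_distrib suminf_mult summable_coef)

lemma diag_integrable: "integrable M diag"
  unfolding diag_def
proof (rule integrable_suminf)
  show "integrable M (\<lambda>x. (cmod (g j x))\<^sup>2)" for j
    by (rule L2_functionsD(2)[OF feature_L2])
  show "AE x in M. summable (\<lambda>i. norm ((cmod (g i x))\<^sup>2))"
    using summable_pointwise by simp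
  show "summable (\<lambda>i. LINT x|M. norm ((cmod (g i x))\<^sup>2))"
    using summable_trace by (simp add: l2_normsq_def)
qed

lemma summable_synth:
  assumes "summable (\<lambda>j. (cmod (a j))\<^sup>2)"
  shows "summable (\<lambda>j. cmod (a j) * cmod (g j x))" "summable (\<lambda>j. a j * g j x)"
proof -
  show *: "summable (\<lambda>j. cmod (a j) * cmod (g j x))"
    by (rule summable_comparison_test'[OF summable_add[OF assms summable_pointwise[of x]]])
       (use cmod_mult_le_sum_squares[of "a _" "cnj (g _ x)"] in \<open>simp add: norm_mult\<close>)
  show "summable (\<lambda>j. a j * g j x)"
    by (rule summable_norm_cancel) (use * in \<open>simp add: norm_mult\<close>)
qed

text \<open>The majorant \<open>diag\<close>, the kernel on the diagonal, is integrable and the same for all sequences of bounded norm;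
it serves as dominating function both here and in the proof of compactness.\<close>

lemma synth_bound:
  assumes "summable (\<lambda>j. (cmod (a j))\<^sup>2)"
  shows "(cmod (synth a x))\<^sup>2 \<le> (\<Sum>j. (cmod (a j))\<^sup>2) * diag x"
proof -
  have "cmod (synth a x) \<le> (\<Sum>j. cmod (a j) * cmod (g j x))"
    unfolding synth_def
    using summable_norm[of "\<lambda>j. a j * g j x"] summable_synth(1)[OF assms, of x] by (simp add: norm_mult)
  hence "(cmod (synth a x))\<^sup>2 \<le> (\<Sum>j. cmod (a j) * cmod (g j x))\<^sup>2"
    by (intro power_mono) auto
  also have "\<dots> \<le> (\<Sum>j. (cmod (a j))\<^sup>2) * diag x"
    unfolding diag_def by (intro cauchy_schwarz_suminf assms summable_pointwise summable_synth)
  finally show ?thesis .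
qed

lemma synth_measurable [measurable]: "synth a \<in> borel_measurable M"
proof -
  note [measurable] = L2_functionsD(1)[OF feature_L2]
  show ?thesis unfolding synth_def by measurable
qed

lemma synth_L2:
  assumes "summable (\<lambda>j. (cmod (a j))\<^sup>2)"
  shows "synth a \<in> L2_functions M"
proof -
  have "integrable M (\<lambda>x. (cmod (synth a x))\<^sup>2)"
  proof (rule Bochner_Integration.integrable_bound)
    show "integrable M (\<lambda>x. (\<Sum>j. (cmod (a j))\<^sup>2) * diag x)"
      using diag_integrable by simp
    show "AE x in M. norm ((cmod (synth a x))\<^sup>2) \<le> norm ((\<Sum>j. (cmod (a j))\<^sup>2) * diag x)"
      using synth_bound[OF assms] diag_nonneg suminf_nonneg[OF assms] by (intro AE_I2) (simp add: abs_mult)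
  qed measurable
  thus ?thesis by (simp add: L2_functions_def)
qed

text \<open>The pointwise bound \<open>\<bar>a\<^sub>j g\<^sub>j f\<bar> \<le> \<bar>g\<^sub>j\<bar>\<^sup>2 + \<bar>a\<^sub>j\<bar>\<^sup>2 \<bar>f\<bar>\<^sup>2\<close> is summable after integration, which allows sum and integral
to be exchanged.\<close>

lemma l2_inner_synth:
  assumes a: "summable (\<lambda>j. (cmod (a j))\<^sup>2)" and f: "f \<in> L2_functions M"
  shows "l2_inner M (synth a) f = (\<Sum>j. a j * cnj (coef f j))"
proof -
  let ?u = "\<lambda>j x. a j * (g j x * cnj (f x))"
  have int: "integrable M (?u j)" for j
    by (intro integrable_mult_right L2_inner_integrable feature_L2 f)
  have bound: "cmod (?u j x) \<le> (cmod (g j x))\<^sup>2 + (cmod (a j))\<^sup>2 * (cmod (f x))\<^sup>2" for j x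
    using cmod_mult_le_sum_squares[of "g j x" "a j * f x"]
    by (simp add: norm_mult power_mult_distrib algebra_simps)
  have swap: "(LINT x|M. (\<Sum>j. ?u j x)) = (\<Sum>j. LINT x|M. ?u j x)"
  proof (rule integral_suminf)
    show "AE x in M. summable (\<lambda>j. norm (?u j x))"
      by (intro AE_I2 summable_comparison_test'[OF summable_add[OF summable_pointwise summable_mult2[OF a]]])
         (use bound in auto)
    show "summable (\<lambda>j. LINT x|M. norm (?u j x))"
    proof (rule summable_comparison_test')
      show "summable (\<lambda>j. l2_normsq M (g j) + (cmod (a j))\<^sup>2 * l2_normsq M f)"
        by (intro summable_add summable_trace summable_mult2 a)
      fix j :: nat
      have "(LINT x|M. norm (?u j x)) \<le> (LINT x|M. (cmod (g j x))\<^sup>2 + (cmod (a j))\<^sup>2 * (cmod (f x))\<^sup>2)"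
        using int[of j] L2_functionsD(2)[OF feature_L2, of j] L2_functionsD(2)[OF f] bound
        by (intro integral_mono) auto
      thus "norm (LINT x|M. norm (?u j x)) \<le> l2_normsq M (g j) + (cmod (a j))\<^sup>2 * l2_normsq M f"
        using L2_functionsD(2)[OF feature_L2, of j] L2_functionsD(2)[OF f] by (simp add: l2_normsq_def)
    qed
  qed (rule int)
  have sum: "(\<Sum>j. ?u j x) = synth a x * cnj (f x)" for x
    unfolding synth_def using summable_synth(2)[OF a, of x]
    by (simp add: suminf_mult2 mult.assoc)
  have int_u: "(LINT x|M. ?u j x) = a j * cnj (coef f j)" for j
    unfolding coef_def l2_inner_cnj by (simp add: l2_inner_def)
  show ?thesis using swap unfolding sum int_u by (simp only: l2_inner_def)
qed

lemma T_L2: "f \<in> L2_functions M \<Longrightarrow> T f \<in> L2_functions M"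
  unfolding T_def by (intro synth_L2 summable_coef)

lemma T_inner:
  assumes "f \<in> L2_functions M" "h \<in> L2_functions M"
  shows "l2_inner M (T f) h = (\<Sum>j. coef f j * cnj (coef h j))"
  unfolding T_def by (intro l2_inner_synth summable_coef assms)

lemma T_self_adjoint:
  assumes f: "f \<in> L2_functions M" and h: "h \<in> L2_functions M"
  shows "l2_inner M (T f) h = l2_inner M f (T h)"
proof -
  have "summable (\<lambda>j. coef h j * cnj (coef f j))"
  proof (rule summable_norm_cancel, rule summable_comparison_test')
    show "summable (\<lambda>j. (cmod (coef h j))\<^sup>2 + (cmod (coef f j))\<^sup>2)"
      by (intro summable_add summable_coef f h)
  qed (use cmod_mult_le_sum_squares in simp)
  hence "(\<lambda>j. coef h j * cnj (coef f j)) sums l2_inner M (T h) f"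
    unfolding T_inner[OF h f] by (rule summable_sums)
  hence "(\<lambda>j. cnj (coef h j * cnj (coef f j))) sums cnj (l2_inner M (T h) f)"
    by (subst sums_cnj)
  hence "(\<Sum>j. coef f j * cnj (coef h j)) = l2_inner M f (T h)"
    by (simp add: sums_iff l2_inner_cnj mult.commute)
  thus ?thesis by (simp add: T_inner f h)
qed

lemma T_quadratic_form:
  assumes "f \<in> L2_functions M"
  shows "l2_inner M (T f) f = of_real (Q f)"
  unfolding T_inner[OF assms assms] Q_def suminf_of_real[OF summable_coef[OF assms]]
  by (simp add: complex_norm_square del: of_real_power)

lemma T_diff:
  assumes "f \<in> L2_functions M" "h \<in> L2_functions M"
  shows "T (\<lambda>x. f x - h x) = (\<lambda>x. T f x - T h x)"
  unfolding T_def synth_def coef_diff[OF assms] left_diff_distrib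
  using summable_synth(2)[OF summable_coef] assms by (intro ext suminf_diff[symmetric]) auto

lemma T_scale:
  assumes "f \<in> L2_functions M"
  shows "T (\<lambda>x. c * f x) = (\<lambda>x. c * T f x)"
  unfolding T_def synth_def coef_scale mult.assoc
  using summable_synth(2)[OF summable_coef[OF assms]] by (intro ext suminf_mult) auto

lemma T_sum:
  assumes "finite I" "\<And>i. i \<in> I \<Longrightarrow> f i \<in> L2_functions M"
  shows "T (\<lambda>x. \<Sum>i\<in>I. c i * f i x) = (\<lambda>x. \<Sum>i\<in>I. c i * T (f i) x)"
  using assms
proof (induction I)
  case empty
  show ?case by (simp add: T_def synth_def coef_def l2_inner_def)
next
  case (insert i I)
  let ?h = "\<lambda>x. \<Sum>i\<in>I. c i * f i x"
  have h: "?h \<in> L2_functions M"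
    by (rule L2_sum) (use insert.prems in auto)
  note h = h L2_scale[OF h, of "-1"]
  have fi: "f i \<in> L2_functions M" using insert.prems by simp
  have "T (\<lambda>x. c i * f i x - (-1 * ?h x)) = (\<lambda>x. c i * T (f i) x - (-1 * T ?h x))"
    unfolding T_diff[OF L2_scale[OF fi] h(2)] T_scale[OF fi] T_scale[OF h(1)] ..
  thus ?case using insert by simp
qed

lemma integral_operator_eq_T:
  assumes f: "f \<in> L2_functions M"
    and K: "AE t in M. complex_of_real (K s t) = (\<Sum>j. g j s * cnj (g j t))"
    and [measurable]: "(\<lambda>t. K s t) \<in> borel_measurable M"
  shows "integral_operator M K f s = T f s"
proof -
  let ?a = "\<lambda>j. cnj (g j s)"
  have a: "summable (\<lambda>j. (cmod (?a j))\<^sup>2)" using summable_pointwise by simp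
  note [measurable] = L2_functionsD(1)[OF f]
  have cnjsynth: "cnj (synth ?a t) = (\<Sum>j. g j s * cnj (g j t))" for t
  proof -
    have "(\<lambda>j. ?a j * g j t) sums synth ?a t"
      unfolding synth_def by (rule summable_sums[OF summable_synth(2)[OF a]])
    hence "(\<lambda>j. cnj (?a j * g j t)) sums cnj (synth ?a t)" by (subst sums_cnj)
    thus ?thesis by (simp add: sums_iff)
  qed
  have "integral_operator M K f s = l2_inner M f (synth ?a)"
    unfolding integral_operator_def l2_inner_def cnjsynth[symmetric]
  proof (rule integral_cong_AE)
    show "AE t in M. complex_of_real (K s t) * f t = f t * cnj (synth ?a t)"
      using K by eventually_elim (simp add: cnjsynth)
  qed measurable
  also have "\<dots> = cnj (\<Sum>j. ?a j * cnj (coef f j))"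
    using l2_inner_synth[OF a f] by (metis l2_inner_cnj)
  also have "\<dots> = T f s"
  proof -
    have "(\<lambda>j. coef f j * g j s) sums T f s"
      unfolding T_def synth_def by (rule summable_sums[OF summable_synth(2)[OF summable_coef[OF f]]])
    hence "(\<lambda>j. cnj (coef f j * g j s)) sums cnj (T f s)" by (subst sums_cnj)
    thus ?thesis by (simp add: sums_iff mult.commute)
  qed
  finally show ?thesis .
qed

section \<open>Eigenvectors by maximising the quadratic form\<close>

text \<open>Each coefficient stays in a fixed disc, so a diagonal argument applies.\<close>

lemma coef_subseq_convergent:
  assumes f: "\<And>n. f n \<in> L2_functions M" and norm: "\<And>n. l2_normsq M (f n) \<le> 1"
  obtains r :: "nat \<Rightarrow> nat" and a where "strict_mono r" "\<And>j. (\<lambda>n. coef (f (r n)) j) \<longlonglongrightarrow> a j"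
proof -
  define P where "P j s \<longleftrightarrow> convergent (\<lambda>n. coef (f (s n)) j)" for j and s :: "nat \<Rightarrow> nat"
  interpret subseqs P
  proof
    fix j and s :: "nat \<Rightarrow> nat"
    let ?B = "cball (0::complex) (sqrt (l2_normsq M (g j)))"
    have "coef (f (s n)) j \<in> ?B" for n
    proof -
      have "(cmod (coef (f (s n)) j))\<^sup>2 \<le> 1 * l2_normsq M (g j)"
        using coef_bound[OF f, of "s n" j] mult_right_mono[OF norm[of "s n"] l2_normsq_nonneg, of M "g j"]
        by (rule order_trans)
      thus ?thesis by (simp add: real_le_rsqrt)
    qed
    moreover have "seq_compact ?B" by (intro compact_imp_seq_compact compact_cball)
    ultimately obtain l r where "strict_mono r" "((\<lambda>n. coef (f (s n)) j) \<circ> r) \<longlonglongrightarrow> l"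
      by (metis seq_compactE)
    thus "\<exists>r'. strict_mono r' \<and> P j (s \<circ> r')"
      by (auto simp: P_def convergent_def o_def)
  qed
  have "P j diagseq" for j
  proof -
    have "P j (diagseq \<circ> ((+) (Suc j)))"

      by (rule diagseq_holds) (use convergent_subseq_convergent in \<open>auto simp: P_def o_def\<close>)
    hence "convergent (\<lambda>n. coef (f (diagseq (n + Suc j))) j)"
      by (simp add: P_def o_def add.commute)
    thus ?thesis
      using convergent_ignore_initial_segment[of "\<lambda>n. coef (f (diagseq n)) j" "Suc j"] by (simp add: P_def)
  qed
  hence "\<forall>j. \<exists>l. (\<lambda>n. coef (f (diagseq n)) j) \<longlonglongrightarrow> l"
    by (simp add: P_def convergent_def)
  hence "\<exists>a. \<forall>j. (\<lambda>n. coef (f (diagseq n)) j) \<longlonglongrightarrow> a j"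
    by (rule choice)
  thus ?thesis using that[OF subseq_diagseq] by blast
qed

text \<open>Convergence of the coefficients forces convergence of \<open>T f\<^sub>n\<close> in norm: the series for \<open>T f\<^sub>n (x)\<close> converges
pointwise by Tannery's theorem, and all these functions are bounded by a fixed multiple of \<open>\<surd>(diag x)\<close>.\<close>

lemma T_compact:
  assumes f: "\<And>n. f n \<in> L2_functions M" and norm: "\<And>n. l2_normsq M (f n) \<le> 1"
    and lim: "\<And>j. (\<lambda>n. coef (f n) j) \<longlonglongrightarrow> a j"
  shows "synth a \<in> L2_functions M"
    and "(\<lambda>n. l2_normsq M (\<lambda>x. T (f n) x - synth a x)) \<longlonglongrightarrow> 0"
proof -
  have cb: "(cmod (coef (f n) j))\<^sup>2 \<le> l2_normsq M (g j)" for n j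
    using coef_bound[OF f, of n j] mult_right_mono[OF norm[of n] l2_normsq_nonneg, of M "g j"] by simp
  have ab: "(cmod (a j))\<^sup>2 \<le> l2_normsq M (g j)" for j
    by (rule LIMSEQ_le_const2[OF tendsto_power[OF tendsto_norm[OF lim]]]) (use cb in auto)
  have a: "summable (\<lambda>j. (cmod (a j))\<^sup>2)"
    by (rule summable_comparison_test'[OF summable_trace]) (use ab in auto)
  show L2: "synth a \<in> L2_functions M" by (rule synth_L2[OF a])
  have square: "(cmod (synth b x))\<^sup>2 \<le> trace * diag x"
    if "\<And>j. (cmod (b j))\<^sup>2 \<le> l2_normsq M (g j)" for b x
  proof -
    have b: "summable (\<lambda>j. (cmod (b j))\<^sup>2)"
      by (rule summable_comparison_test'[OF summable_trace]) (use that in auto)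
    have "(\<Sum>j. (cmod (b j))\<^sup>2) \<le> trace"
      unfolding trace_def by (intro suminf_le that b summable_trace)
    thus ?thesis
      using synth_bound[OF b, of x] mult_right_mono[OF _ diag_nonneg] order_trans by blast
  qed
  have pointwise: "(\<lambda>n. T (f n) x) \<longlonglongrightarrow> synth a x" for x
  proof -
    let ?b = "\<lambda>j. l2_normsq M (g j) + (cmod (g j x))\<^sup>2"
    have le: "cmod (coef (f n) j * g j x) \<le> ?b j" for n j
      using cmod_mult_le_sum_squares[of "coef (f n) j" "cnj (g j x)"] cb[of n j] by simp
    have "eventually (\<lambda>n. summable (\<lambda>j. norm (coef (f n) j * g j x))) sequentially \<and>
        summable (\<lambda>j. norm (a j * g j x)) \<and>
        (\<lambda>n. \<Sum>j. coef (f n) j * g j x) \<longlonglongrightarrow> (\<Sum>j. a j * g j x)"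
    proof (rule tannerys_theorem[where M = ?b])
      show "(\<lambda>n. coef (f n) j * g j x) \<longlonglongrightarrow> a j * g j x" for j
        by (intro tendsto_intros lim)
      show "summable ?b" by (intro summable_add summable_trace summable_pointwise)
    qed (use le in \<open>simp_all add: always_eventually\<close>)
    thus ?thesis by (simp add: T_def synth_def)
  qed
  have "(\<lambda>n. LINT x|M. (cmod (T (f n) x - synth a x))\<^sup>2) \<longlonglongrightarrow> (LINT x|M. 0)"
  proof (rule integral_dominated_convergence[where w = "\<lambda>x. 4 * (trace * diag x)"])
    show "integrable M (\<lambda>x. 4 * (trace * diag x))" using diag_integrable by simp
    show "AE x in M. (\<lambda>n. (cmod (T (f n) x - synth a x))\<^sup>2) \<longlonglongrightarrow> 0"
    proof (rule AE_I2)
      fix x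
      have "(\<lambda>n. (cmod (T (f n) x - synth a x))\<^sup>2) \<longlonglongrightarrow> (cmod (synth a x - synth a x))\<^sup>2"
        by (intro tendsto_intros pointwise)
      thus "(\<lambda>n. (cmod (T (f n) x - synth a x))\<^sup>2) \<longlonglongrightarrow> 0" by simp
    qed
    show "AE x in M. norm ((cmod (T (f n) x - synth a x))\<^sup>2) \<le> 4 * (trace * diag x)" for n
    proof (rule AE_I2)
      fix x
      have "(cmod (T (f n) x))\<^sup>2 \<le> trace * diag x" "(cmod (synth a x))\<^sup>2 \<le> trace * diag x"
        unfolding T_def using square cb ab by blast+
      thus "norm ((cmod (T (f n) x - synth a x))\<^sup>2) \<le> 4 * (trace * diag x)"
        using cmod_add_squared_le[of "T (f n) x" "- synth a x"] by simp
    qed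
    show "(\<lambda>x. (cmod (T (f n) x - synth a x))\<^sup>2) \<in> borel_measurable M" for n
      unfolding T_def by measurable
  qed simp
  thus "(\<lambda>n. l2_normsq M (\<lambda>x. T (f n) x - synth a x)) \<longlonglongrightarrow> 0"
    by (simp add: l2_normsq_def)
qed

text \<open>An almost maximiser of the form is almost an eigenvector. Positivity of \<open>Q\<close> at \<open>f - T f / m\<close>, with the
bound for \<open>Q (T f)\<close>, gives \<open>\<parallel>T f\<parallel>\<^sup>2 \<le> m Q f\<close>, and the rest is the expansion of \<open>\<parallel>T f - m f\<parallel>\<^sup>2\<close>.\<close>

lemma residual_bound:
  assumes f: "f \<in> L2_functions M" and m: "m > 0" and Tf: "Q (T f) \<le> m * l2_normsq M (T f)"
  shows "l2_normsq M (\<lambda>x. T f x - of_real m * f x) \<le> m * (m * l2_normsq M f - Q f)"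
proof -
  \<comment> \<open>at an exact eigenvector for \<open>m\<close> this vanishes\<close>
  let ?w = "\<lambda>x. f x - of_real (1 / m) * T f x"
  note L2 = f T_L2[OF f] T_L2[OF T_L2[OF f]]
  have w: "?w \<in> L2_functions M" by (intro L2_diff L2_scale L2)
  have Tw: "T ?w = (\<lambda>x. T f x - of_real (1 / m) * T (T f) x)"
    by (simp only: T_diff[OF L2(1) L2_scale[OF L2(2)]] T_scale[OF L2(2)])
  have "complex_of_real (Q ?w) = l2_inner M (T ?w) ?w"
    by (rule T_quadratic_form[OF w, symmetric])
  also have "\<dots> = l2_inner M (T f) f - of_real (1 / m) * l2_inner M (T f) (T f)
      - of_real (1 / m) * (l2_inner M (T (T f)) f - of_real (1 / m) * l2_inner M (T (T f)) (T f))"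
    unfolding Tw
    by (simp add: l2_inner_diff_left l2_inner_diff_right l2_inner_scale_left l2_inner_scale_right
        L2 L2_diff L2_scale del: of_real_divide)
  also have "l2_inner M (T (T f)) f = l2_inner M (T f) (T f)"
    by (rule T_self_adjoint[OF L2(2,1)])
  also have "l2_inner M (T f) f - of_real (1 / m) * l2_inner M (T f) (T f)
      - of_real (1 / m) * (l2_inner M (T f) (T f) - of_real (1 / m) * l2_inner M (T (T f)) (T f))
      = of_real (Q f - 1 / m * l2_normsq M (T f) - 1 / m * (l2_normsq M (T f) - 1 / m * Q (T f)))"
    by (simp add: T_quadratic_form L2 l2_inner_self)
  finally have "Q ?w = Q f - 1 / m * l2_normsq M (T f) - 1 / m * (l2_normsq M (T f) - 1 / m * Q (T f))"
    by (simp only: of_real_eq_iff)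
  moreover have "0 \<le> Q ?w" by (rule Q_nonneg[OF w])
  moreover have "1 / m * Q (T f) \<le> l2_normsq M (T f)"
    using Tf m by (simp add: field_simps)
  hence "0 \<le> 1 / m * (l2_normsq M (T f) - 1 / m * Q (T f))"
    using m by (intro mult_nonneg_nonneg) auto
  ultimately have "1 / m * l2_normsq M (T f) \<le> Q f" by linarith
  hence *: "l2_normsq M (T f) \<le> m * Q f" using m by (simp add: field_simps)
  have "l2_normsq M (\<lambda>x. T f x - of_real m * f x)
      = l2_normsq M (T f) + m\<^sup>2 * l2_normsq M f - 2 * (m * Q f)"
    using m by (simp add: l2_normsq_diff L2 L2_scale l2_normsq_scale l2_inner_scale_right T_quadratic_form)
  thus ?thesis using * by (simp add: power2_eq_square algebra_simps)
qed

text \<open>The supremum \<open>m\<close> of the form on the unit sphere of the orthogonal complement of \<open>U\<close> is an eigenvalue. The complement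
is invariant under \<open>T\<close>, so \<open>residual_bound\<close> applies to a maximising sequence, and by compactness \<open>T f\<^sub>n\<close>, hence
\<open>m f\<^sub>n\<close>, converges along a subsequence. The limit is explicitly \<open>synth a\<close> for the limits \<open>a\<close> of the
coefficients, so no Cauchy sequence needs a limit, and its coefficients are \<open>m a\<close>, so the eigenvalue equation holds at
every point.\<close>

theorem exists_eigenvector_orthogonal:
  assumes U: "\<And>u. u \<in> U \<Longrightarrow> u \<in> L2_functions M"
    and eig: "\<And>u. u \<in> U \<Longrightarrow> \<exists>l. AE x in M. T u x = l * u x"
    and f: "f \<in> L2_functions M" "\<And>u. u \<in> U \<Longrightarrow> l2_inner M f u = 0" "l2_normsq M f > 0"
    and r: "r > 0" "Q f \<ge> r * l2_normsq M f"
  obtains h \<mu> where "h \<in> L2_functions M" "\<And>u. u \<in> U \<Longrightarrow> l2_inner M h u = 0" "l2_normsq M h > 0"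
    "\<mu> \<ge> r" "\<And>x. T h x = of_real \<mu> * h x"
proof -
  define P where "P = {f \<in> L2_functions M. \<forall>u\<in>U. l2_inner M f u = 0}"
  define S where "S = Q ` {f \<in> P. l2_normsq M f = 1}"
  define m where "m = Sup S"
  have P_L2: "f \<in> L2_functions M" if "f \<in> P" for f using that by (simp add: P_def)
  have P_scale: "(\<lambda>x. c * f x) \<in> P" if "f \<in> P" for c f
    using that by (auto simp: P_def L2_scale l2_inner_scale_left)
  have P_T: "T f \<in> P" if "f \<in> P" for f
  proof -
    have "l2_inner M (T f) u = 0" if u: "u \<in> U" for u
    proof -
      obtain l where l: "AE x in M. T u x = l * u x" using eig[OF u] by blast
      have "l2_inner M (T f) u = l2_inner M f (T u)"
        by (rule T_self_adjoint[OF P_L2[OF \<open>f \<in> P\<close>] U[OF u]])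
      also have "\<dots> = l2_inner M f (\<lambda>x. l * u x)"
        using l L2_functionsD(1)[OF P_L2[OF \<open>f \<in> P\<close>]] L2_functionsD(1)[OF T_L2[OF U[OF u]]]
          L2_functionsD(1)[OF L2_scale[OF U[OF u]]]
        by (intro l2_inner_cong_AE) auto
      also have "\<dots> = 0" using \<open>f \<in> P\<close> u by (simp add: P_def l2_inner_scale_right)
      finally show ?thesis .
    qed
    thus ?thesis using T_L2[OF P_L2[OF that]] by (simp add: P_def)
  qed
  have normalise: "\<exists>c. l2_normsq M (\<lambda>x. c * f x) = 1 \<and> Q (\<lambda>x. c * f x) = Q f / l2_normsq M f"
    if "f \<in> P" "l2_normsq M f > 0" for f
  proof -
    let ?c = "complex_of_real (1 / sqrt (l2_normsq M f))"
    have "(cmod ?c)\<^sup>2 = 1 / l2_normsq M f" using that(2) by (simp add: norm_divide power_divide)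
    hence "l2_normsq M (\<lambda>x. ?c * f x) = 1 \<and> Q (\<lambda>x. ?c * f x) = Q f / l2_normsq M f"
      unfolding l2_normsq_scale Q_scale[OF P_L2[OF that(1)]] using that(2) by simp
    thus ?thesis by blast
  qed
  have bdd: "bdd_above S"
    unfolding S_def by (rule bdd_aboveI[of _ trace]) (use Q_le_trace P_L2 in fastforce)
  have Q_le: "Q f \<le> m * l2_normsq M f" if "f \<in> P" for f
  proof (cases "l2_normsq M f = 0")
    case True
    thus ?thesis using Q_le_trace[OF P_L2[OF that]] by simp
  next
    case False
    hence pos: "l2_normsq M f > 0" using l2_normsq_nonneg[of M f] by simp
    then obtain c where c: "l2_normsq M (\<lambda>x. c * f x) = 1" "Q (\<lambda>x. c * f x) = Q f / l2_normsq M f"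
      using normalise[OF \<open>f \<in> P\<close> pos] by blast
    have "Q f / l2_normsq M f \<in> S"
      unfolding S_def using c P_scale[OF that] by (metis (mono_tags, lifting) image_eqI mem_Collect_eq)
    hence "Q f / l2_normsq M f \<le> m" unfolding m_def by (rule cSup_upper[OF _ bdd])
    thus ?thesis using pos by (simp add: field_simps)
  qed
  have fP: "f \<in> P" using f by (simp add: P_def)
  have "r * l2_normsq M f \<le> m * l2_normsq M f" using r(2) Q_le[OF fP] by linarith
  hence m: "m \<ge> r" "m > 0" using f(3) r(1) by simp_all
  have ne: "S \<noteq> {}"
    using normalise[OF fP f(3)] P_scale[OF fP] unfolding S_def by blast
  have "\<exists>f. f \<in> P \<and> l2_normsq M f = 1 \<and> m - 1 / real (Suc n) < Q f" for n
  proof -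
    have "m - 1 / real (Suc n) < Sup S" unfolding m_def by simp
    thus ?thesis using less_cSup_iff[OF ne bdd] unfolding S_def by blast
  qed
  then obtain F where F: "\<And>n. F n \<in> P" "\<And>n. l2_normsq M (F n) = 1" "\<And>n. m - 1 / real (Suc n) < Q (F n)"
    by metis
  obtain s a where s: "strict_mono s" and a: "\<And>j. (\<lambda>n. coef (F (s n)) j) \<longlonglongrightarrow> a j"
    using coef_subseq_convergent[of F] F(1,2) P_L2 by (metis order_refl)
  define G where "G n = F (s n)" for n
  have G: "G n \<in> P" "G n \<in> L2_functions M" "l2_normsq M (G n) = 1" for n
    using F P_L2 by (auto simp: G_def)
  define h where "h = synth a"
  have h: "h \<in> L2_functions M" and Th: "(\<lambda>n. l2_normsq M (\<lambda>x. T (G n) x - h x)) \<longlonglongrightarrow> 0"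
    using T_compact[of G a] G a by (simp_all add: h_def G_def)
  have residual: "(\<lambda>n. l2_normsq M (\<lambda>x. T (G n) x - of_real m * G n x)) \<longlonglongrightarrow> 0"
  proof (rule tendsto_sandwich[OF _ _ tendsto_const])
    show "(\<lambda>n. m * (1 / real (Suc n))) \<longlonglongrightarrow> 0"
      using tendsto_mult_right_zero[OF LIMSEQ_inverse_real_of_nat, of m] by (simp add: inverse_eq_divide)
    have "l2_normsq M (\<lambda>x. T (G n) x - of_real m * G n x) \<le> m * (1 / real (Suc n))" for n
    proof -
      have "l2_normsq M (\<lambda>x. T (G n) x - of_real m * G n x) \<le> m * (m * 1 - Q (G n))"
        using residual_bound[OF G(2) m(2) Q_le[OF P_T[OF G(1)]], of n] by (simp add: G(3))
      also have "\<dots> \<le> m * (1 / real (Suc (s n)))"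
        using F(3)[of "s n"] m by (intro mult_left_mono) (auto simp: G_def)
      also have "\<dots> \<le> m * (1 / real (Suc n))"
        using seq_suble[OF s, of n] m by (intro mult_left_mono divide_left_mono) auto
      finally show ?thesis .
    qed
    thus "eventually (\<lambda>n. l2_normsq M (\<lambda>x. T (G n) x - of_real m * G n x) \<le> m * (1 / real (Suc n))) sequentially"
      by simp
  qed (simp add: l2_normsq_nonneg)
  define E where "E n = (\<lambda>x. of_real m * G n x - h x)" for n
  have E_L2: "E n \<in> L2_functions M" for n
    unfolding E_def by (intro L2_diff L2_scale G h)
  have E: "(\<lambda>n. l2_normsq M (E n)) \<longlonglongrightarrow> 0"
  proof (rule tendsto_sandwich[OF _ _ tendsto_const])
    let ?R = "\<lambda>n x. T (G n) x - of_real m * G n x" and ?C = "\<lambda>n x. T (G n) x - h x"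
    show "(\<lambda>n. 2 * l2_normsq M (?C n) + 2 * l2_normsq M (?R n)) \<longlonglongrightarrow> 0"
      using tendsto_add[OF tendsto_mult_right_zero[OF Th, of 2] tendsto_mult_right_zero[OF residual, of 2]] by simp
    have "l2_normsq M (E n) \<le> 2 * l2_normsq M (?C n) + 2 * l2_normsq M (?R n)" for n
    proof -
      have "E n = (\<lambda>x. ?C n x + (-1) * ?R n x)" by (simp add: E_def)
      moreover have "l2_normsq M (\<lambda>x. ?C n x + (-1) * ?R n x)
          \<le> 2 * l2_normsq M (?C n) + 2 * l2_normsq M (\<lambda>x. (-1) * ?R n x)"
        by (intro l2_normsq_add_le L2_diff L2_scale T_L2 G h)
      ultimately show ?thesis by (simp only: l2_normsq_scale) simp
    qed
    thus "eventually (\<lambda>n. l2_normsq M (E n) \<le> 2 * l2_normsq M (?C n) + 2 * l2_normsq M (?R n)) sequentially"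
      by simp
  qed (simp add: l2_normsq_nonneg)
  \<comment> \<open>\<open>m G\<^sub>n\<close> tends to \<open>h\<close> in norm, hence weakly; tested against features this identifies the coefficients
    of \<open>h\<close>\<close>
  have weak: "(\<lambda>n. of_real m * l2_inner M (G n) u) \<longlonglongrightarrow> l2_inner M h u" if u: "u \<in> L2_functions M" for u
  proof -
    have "(\<lambda>n. l2_inner M (E n) u) \<longlonglongrightarrow> 0"
    proof (rule Lim_null_comparison)
      show "eventually (\<lambda>n. norm (l2_inner M (E n) u) \<le> sqrt (l2_normsq M (E n) * l2_normsq M u)) sequentially"
        using l2_cauchy_schwarz[OF E_L2 u] by (simp add: real_le_rsqrt)
      show "(\<lambda>n. sqrt (l2_normsq M (E n) * l2_normsq M u)) \<longlonglongrightarrow> 0"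
        using tendsto_real_sqrt[OF tendsto_mult_left_zero[OF E, of "l2_normsq M u"]] by simp
    qed
    hence "(\<lambda>n. l2_inner M (E n) u + l2_inner M h u) \<longlonglongrightarrow> 0 + l2_inner M h u"
      by (intro tendsto_intros)
    moreover have "l2_inner M (E n) u + l2_inner M h u = of_real m * l2_inner M (G n) u" for n
      unfolding E_def l2_inner_diff_left[OF L2_scale[OF G(2)] h u] l2_inner_scale_left by simp
    ultimately show ?thesis by simp
  qed
  have "coef h j = of_real m * a j" for j
  proof (rule LIMSEQ_unique)
    show "(\<lambda>n. of_real m * coef (G n) j) \<longlonglongrightarrow> coef h j"
      unfolding coef_def by (rule weak[OF feature_L2])
    show "(\<lambda>n. of_real m * coef (G n) j) \<longlonglongrightarrow> of_real m * a j"
      unfolding G_def by (intro tendsto_intros a)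
  qed
  moreover have "summable (\<lambda>j. a j * g j x)" for x
  proof -
    have "(\<lambda>j. a j) = (\<lambda>j. of_real (1 / m) * coef h j)" using m calculation by auto
    hence "a = coef (\<lambda>x. of_real (1 / m) * h x)" by (simp only: fun_eq_iff coef_scale simp_thms)
    thus ?thesis using summable_synth(2)[OF summable_coef[OF L2_scale[OF h]]] by (simp only:)
  qed
  ultimately have eigen: "T h x = of_real m * h x" for x
    by (simp add: T_def h_def synth_def mult.assoc suminf_mult)
  have "l2_inner M h u = 0" if "u \<in> U" for u
  proof (rule LIMSEQ_unique[OF weak[OF U[OF that]]])
    show "(\<lambda>n. of_real m * l2_inner M (G n) u) \<longlonglongrightarrow> 0"
      using G(1) that by (simp add: P_def)
  qed
  moreover have "l2_normsq M h > 0"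
  proof (rule ccontr)
    assume "\<not> l2_normsq M h > 0"
    hence h0: "l2_normsq M h = 0" using l2_normsq_nonneg[of M h] by simp
    have "m\<^sup>2 \<le> 2 * l2_normsq M (E n)" for n
    proof -
      have "m\<^sup>2 = l2_normsq M (\<lambda>x. of_real m * G n x)" by (simp add: l2_normsq_scale G)
      also have "(\<lambda>x. of_real m * G n x) = (\<lambda>x. E n x + h x)" by (simp add: E_def)
      also have "l2_normsq M \<dots> \<le> 2 * l2_normsq M (E n) + 2 * l2_normsq M h"
        by (rule l2_normsq_add_le[OF E_L2 h])
      finally show ?thesis using h0 by simp
    qed
    hence "m\<^sup>2 \<le> 2 * 0"
      by (intro LIMSEQ_le_const[OF tendsto_mult_left[OF E]]) auto
    thus False using m by simp
  qed
  ultimately show ?thesis using that[OF h _ _ m(1) eigen] by blast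
qed

end

section \<open>Counting eigenvalues with test spaces\<close>

text \<open>Elimination: an unknown \<open>p\<close> that occurs in the last equation is expressed by the others, which leaves a system
with one equation and one unknown less.\<close>

lemma homogeneous_system_nontrivial:
  fixes A :: "nat \<Rightarrow> 'i \<Rightarrow> 'k :: field"
  assumes "finite I" "m < card I"
  shows "\<exists>c. (\<exists>i\<in>I. c i \<noteq> 0) \<and> (\<forall>r<m. (\<Sum>i\<in>I. c i * A r i) = 0)"
  using assms
proof (induction m arbitrary: A I)
  case 0
  hence "I \<noteq> {}" by auto
  thus ?case by (intro exI[of _ "\<lambda>_. 1"]) auto
next
  case (Suc m)
  show ?case
  proof (cases "\<forall>i\<in>I. A m i = 0")
    case True
    obtain c where c: "\<exists>i\<in>I. c i \<noteq> 0" "\<forall>r<m. (\<Sum>i\<in>I. c i * A r i) = 0"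
      using Suc.IH[OF Suc.prems(1) Suc_lessD[OF Suc.prems(2)], of A] by blast
    have "(\<Sum>i\<in>I. c i * A m i) = 0" by (rule sum.neutral) (use True in auto)
    thus ?thesis using c by (auto simp: less_Suc_eq)
  next
    case False
    then obtain p where p: "p \<in> I" "A m p \<noteq> 0" by blast
    define B where "B r i = A r i - A r p * A m i / A m p" for r i
    let ?J = "I - {p}"
    obtain c where c: "\<exists>i\<in>?J. c i \<noteq> 0" "\<forall>r<m. (\<Sum>i\<in>?J. c i * B r i) = 0"
    proof -
      have "finite ?J" "m < card ?J" using Suc.prems p by auto
      from Suc.IH[OF this, of B] show ?thesis using that by blast
    qed
    define d where "d i = (if i = p then - (\<Sum>i\<in>?J. c i * A m i) / A m p else c i)" for i
    have split: "(\<Sum>i\<in>I. d i * A r i) = d p * A r p + (\<Sum>i\<in>?J. c i * A r i)" for r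
      using Suc.prems p by (subst sum.remove[of I p]) (auto simp: d_def intro!: sum.cong)
    have "(\<Sum>i\<in>I. d i * A r i) = (\<Sum>i\<in>?J. c i * B r i)" for r
      unfolding split B_def right_diff_distrib sum_subtractf
      by (simp add: d_def sum_distrib_right sum_distrib_left sum_divide_distrib mult_ac)
    moreover have "(\<Sum>i\<in>?J. c i * B m i) = 0"
      using p by (simp add: B_def)
    ultimately have "\<forall>r<Suc m. (\<Sum>i\<in>I. d i * A r i) = 0"
      using c(2) by (auto simp: less_Suc_eq)
    moreover have "\<exists>i\<in>I. d i \<noteq> 0" using c(1) by (auto simp: d_def)
    ultimately show ?thesis by blast
  qed
qed

text \<open>The list of eigenvalues is turned into a list of eigenfunctions: the indices that carry a given eigenvalue are
matched with the elements of a basis of its eigenspace.\<close>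

lemma listed_eigenfunctions:
  assumes "lists_positive_eigenvalues M T \<delta>"
  obtains v where
    "\<And>j. 1 \<le> j \<Longrightarrow> \<delta> j > 0 \<Longrightarrow> v j \<in> eigenspace M T (\<delta> j)"
    "\<And>\<mu> c. \<mu> > 0 \<Longrightarrow> AE x in M. (\<Sum>j | 1 \<le> j \<and> \<delta> j = \<mu>. c j * v j x) = 0 \<Longrightarrow>
       \<forall>j. 1 \<le> j \<and> \<delta> j = \<mu> \<longrightarrow> c j = 0"
    "\<And>\<mu> f. \<mu> > 0 \<Longrightarrow> f \<in> eigenspace M T \<mu> \<Longrightarrow>
       \<exists>c. AE x in M. f x = (\<Sum>j | 1 \<le> j \<and> \<delta> j = \<mu>. c j * v j x)"
proof -
  define J where "J \<mu> = {j. 1 \<le> j \<and> \<delta> j = \<mu>}" for \<mu>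
  have fin: "finite (J \<mu>)" and dim: "has_dim_mod_AE M (eigenspace M T \<mu>) (card (J \<mu>))" if "\<mu> > 0" for \<mu>
    using assms that by (auto simp: lists_positive_eigenvalues_def J_def)
  define basis where "basis \<mu> b \<longleftrightarrow> (\<forall>i<card (J \<mu>). b i \<in> eigenspace M T \<mu>) \<and>
      (\<forall>c. (AE x in M. (\<Sum>i<card (J \<mu>). c i * b i x) = 0) \<longrightarrow> (\<forall>i<card (J \<mu>). c i = 0)) \<and>
      (\<forall>f\<in>eigenspace M T \<mu>. \<exists>c. AE x in M. f x = (\<Sum>i<card (J \<mu>). c i * b i x))" for \<mu> b
  have "\<forall>\<mu>. \<exists>b. \<mu> > 0 \<longrightarrow> basis \<mu> b"
    using dim unfolding has_dim_mod_AE_def basis_def by blast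
  from choice[OF this] obtain b where "\<And>\<mu>. \<mu> > 0 \<Longrightarrow> basis \<mu> (b \<mu>)" by blast
  hence b: "\<And>\<mu> i. \<mu> > 0 \<Longrightarrow> i < card (J \<mu>) \<Longrightarrow> b \<mu> i \<in> eigenspace M T \<mu>"
    "\<And>\<mu> c. \<mu> > 0 \<Longrightarrow> AE x in M. (\<Sum>i<card (J \<mu>). c i * b \<mu> i x) = 0 \<Longrightarrow> \<forall>i<card (J \<mu>). c i = 0"
    "\<And>\<mu> f. \<mu> > 0 \<Longrightarrow> f \<in> eigenspace M T \<mu> \<Longrightarrow> \<exists>c. AE x in M. f x = (\<Sum>i<card (J \<mu>). c i * b \<mu> i x)"
    by (simp_all add: basis_def)
  have "\<forall>\<mu>. \<exists>e. \<mu> > 0 \<longrightarrow> bij_betw e (J \<mu>) {..<card (J \<mu>)}"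
    using ex_bij_betw_finite_nat[OF fin] by (auto simp: atLeast0LessThan)
  from choice[OF this] obtain e where e: "\<And>\<mu>. \<mu> > 0 \<Longrightarrow> bij_betw (e \<mu>) (J \<mu>) {..<card (J \<mu>)}"
    by blast
  define v where "v j = b (\<delta> j) (e (\<delta> j) j)" for j
  have reindex: "(\<Sum>j\<in>J \<mu>. c (e \<mu> j) * v j x) = (\<Sum>i<card (J \<mu>). c i * b \<mu> i x)" if "\<mu> > 0" for \<mu> c x
    using sum.reindex_bij_betw[OF e[OF that], of "\<lambda>i. c i * b \<mu> i x", symmetric]
    by (simp add: v_def J_def)
  show ?thesis
  proof (rule that[of v, folded J_def])
    fix j :: nat assume "1 \<le> j" "\<delta> j > 0"
    hence "e (\<delta> j) j < card (J (\<delta> j))" using e[of "\<delta> j"] by (auto simp: bij_betw_def J_def)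
    thus "v j \<in> eigenspace M T (\<delta> j)" using b(1) \<open>\<delta> j > 0\<close> by (simp add: v_def)
  next
    fix \<mu> c assume \<mu>: "\<mu> > 0" and 0: "AE x in M. (\<Sum>j\<in>J \<mu>. c j * v j x) = 0"
    let ?d = "\<lambda>i. c (inv_into (J \<mu>) (e \<mu>) i)"
    have inv: "inv_into (J \<mu>) (e \<mu>) (e \<mu> j) = j" if "j \<in> J \<mu>" for j
      using e[OF \<mu>] that by (simp add: bij_betw_def)
    have "(\<Sum>j\<in>J \<mu>. c j * v j x) = (\<Sum>i<card (J \<mu>). ?d i * b \<mu> i x)" for x
      unfolding reindex[OF \<mu>, of ?d x, symmetric] by (intro sum.cong) (auto simp: inv)
    hence "AE x in M. (\<Sum>i<card (J \<mu>). ?d i * b \<mu> i x) = 0" using 0 by simp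
    hence *: "?d i = 0" if "i < card (J \<mu>)" for i using b(2)[OF \<mu>, of ?d] that by blast
    have "c j = 0" if "j \<in> J \<mu>" for j
      using *[of "e \<mu> j"] inv[OF that] e[OF \<mu>] that by (auto simp: bij_betw_def)
    thus "\<forall>j. 1 \<le> j \<and> \<delta> j = \<mu> \<longrightarrow> c j = 0" by (auto simp: J_def)
  next
    fix \<mu> f assume \<mu>: "\<mu> > 0" and f: "f \<in> eigenspace M T \<mu>"
    then obtain c where "AE x in M. f x = (\<Sum>i<card (J \<mu>). c i * b \<mu> i x)" using b(3) by blast
    hence "AE x in M. f x = (\<Sum>j\<in>J \<mu>. c (e \<mu> j) * v j x)" by (simp only: reindex[OF \<mu>])
    thus "\<exists>c. AE x in M. f x = (\<Sum>j\<in>J \<mu>. c j * v j x)" by (rule exI[of _ "\<lambda>j. c (e \<mu> j)"])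
  qed
qed

context summable_features
begin

lemma T_inner_eigenfunction:
  assumes u: "u \<in> eigenspace M T \<mu>" and f: "f \<in> L2_functions M"
  shows "l2_inner M (T u) f = of_real \<mu> * l2_inner M u f"
proof -
  have u': "u \<in> L2_functions M" and eq: "AE x in M. T u x = of_real \<mu> * u x"
    using u by (auto simp: eigenspace_def)
  show ?thesis
    unfolding l2_inner_scale_left[symmetric]
    using eq L2_functionsD(1)[OF T_L2[OF u']] L2_functionsD(1)[OF L2_scale[OF u']] L2_functionsD(1)[OF f]
    by (intro l2_inner_cong_AE) auto
qed

lemma eigenfunctions_orthogonal:
  assumes u: "u \<in> eigenspace M T \<mu>" and w: "w \<in> eigenspace M T \<nu>" and "\<mu> \<noteq> \<nu>"
  shows "l2_inner M u w = 0"
proof -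
  have L2: "u \<in> L2_functions M" "w \<in> L2_functions M" using u w by (auto simp: eigenspace_def)
  have "of_real \<mu> * l2_inner M u w = l2_inner M u (T w)"
    using T_inner_eigenfunction[OF u L2(2)] T_self_adjoint[OF L2] by simp
  also have "\<dots> = cnj (l2_inner M (T w) u)" by (simp add: l2_inner_cnj)
  also have "\<dots> = of_real \<nu> * l2_inner M u w"
    by (simp add: T_inner_eigenfunction[OF w L2(1)] l2_inner_cnj)
  finally show ?thesis using \<open>\<mu> \<noteq> \<nu>\<close> by simp
qed

text \<open>The difference of the two sides is a squared norm, that of the combination with coefficients
\<open>\<surd>(\<mu>\<^sub>j - r) c\<^sub>j\<close>: inner products of eigenfunctions vanish unless the eigenvalues agree, and then the two
square roots multiply to \<open>\<mu>\<^sub>j - r\<close>. The argument works for any basis inside an eigenspace.\<close>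

lemma Q_ge_on_eigenspan:
  assumes v: "\<And>j. j \<in> I \<Longrightarrow> v j \<in> eigenspace M T (\<mu> j)" and r: "\<And>j. j \<in> I \<Longrightarrow> r \<le> \<mu> j"
    and I: "finite I"
  defines "f \<equiv> (\<lambda>c x. \<Sum>j\<in>I. c j * v j x)"
  shows "r * l2_normsq M (f c) \<le> Q (f c)"
proof -
  have v_L2: "v j \<in> L2_functions M" if "j \<in> I" for j using v[OF that] by (simp add: eigenspace_def)
  have f_L2: "f c \<in> L2_functions M" for c unfolding f_def by (intro L2_sum v_L2)
  have Tf: "T (f c) = (\<lambda>x. \<Sum>j\<in>I. c j * T (v j) x)" for c
    unfolding f_def by (intro T_sum I v_L2)
  have expand: "l2_inner M (f c) (f d) = (\<Sum>i\<in>I. \<Sum>j\<in>I. c i * (cnj (d j) * l2_inner M (v i) (v j)))" for c d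
  proof -
    have "l2_inner M (f c) (f d) = (\<Sum>i\<in>I. c i * l2_inner M (v i) (f d))"
      unfolding f_def by (rule l2_inner_sum_left[OF v_L2 f_L2[unfolded f_def]])
    also have "\<dots> = (\<Sum>i\<in>I. c i * (\<Sum>j\<in>I. cnj (d j) * l2_inner M (v i) (v j)))"
      unfolding f_def by (intro sum.cong refl) (simp only: l2_inner_sum_right[OF v_L2 v_L2])
    finally show ?thesis by (simp only: sum_distrib_left)
  qed
  have Q: "l2_inner M (T (f c)) (f c) = (\<Sum>i\<in>I. \<Sum>j\<in>I. c i * (cnj (c j) * (of_real (\<mu> i) * l2_inner M (v i) (v j))))"
  proof -
    have "l2_inner M (T (f c)) (f c) = (\<Sum>i\<in>I. c i * l2_inner M (T (v i)) (f c))"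
      unfolding Tf by (rule l2_inner_sum_left[OF T_L2[OF v_L2] f_L2])
    also have "\<dots> = (\<Sum>i\<in>I. c i * (\<Sum>j\<in>I. cnj (c j) * l2_inner M (T (v i)) (v j)))"
      unfolding f_def by (intro sum.cong refl) (simp only: l2_inner_sum_right[OF v_L2 T_L2[OF v_L2]])
    also have "\<dots> = (\<Sum>i\<in>I. c i * (\<Sum>j\<in>I. cnj (c j) * (of_real (\<mu> i) * l2_inner M (v i) (v j))))"
      by (intro sum.cong refl arg_cong2[where f = "(*)"] T_inner_eigenfunction v v_L2)
    finally show ?thesis by (simp only: sum_distrib_left)
  qed
  define s where "s j = sqrt (\<mu> j - r)" for j
  have "complex_of_real (Q (f c) - r * l2_normsq M (f c))
      = l2_inner M (T (f c)) (f c) - of_real r * l2_inner M (f c) (f c)"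
    by (simp add: T_quadratic_form[OF f_L2] l2_inner_self)
  also have "\<dots> = (\<Sum>i\<in>I. \<Sum>j\<in>I. c i * (cnj (c j) * (of_real (\<mu> i - r) * l2_inner M (v i) (v j))))"
    unfolding Q expand sum_distrib_left sum_subtractf[symmetric]
    by (intro sum.cong refl) (simp add: algebra_simps)
  also have "\<dots> = (\<Sum>i\<in>I. \<Sum>j\<in>I. (c i * of_real (s i)) * (cnj (c j * of_real (s j)) * l2_inner M (v i) (v j)))"
  proof (intro sum.cong refl)
    fix i j assume ij: "i \<in> I" "j \<in> I"
    show "c i * (cnj (c j) * (of_real (\<mu> i - r) * l2_inner M (v i) (v j))) =
        (c i * of_real (s i)) * (cnj (c j * of_real (s j)) * l2_inner M (v i) (v j))"
    proof (cases "\<mu> i = \<mu> j")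
      case True
      have "s i * s j = \<mu> i - r" using r[OF ij(1)] True by (simp add: s_def)
      hence "complex_of_real (\<mu> i - r) = of_real (s i) * of_real (s j)" by (simp flip: of_real_mult)
      thus ?thesis by (simp add: mult_ac del: of_real_diff)
    next
      case False
      thus ?thesis using eigenfunctions_orthogonal[OF v[OF ij(1)] v[OF ij(2)]] by simp
    qed
  qed
  also have "\<dots> = of_real (l2_normsq M (f (\<lambda>j. c j * of_real (s j))))"
    unfolding expand[symmetric] by (rule l2_inner_self)
  finally have "Q (f c) - r * l2_normsq M (f c) = l2_normsq M (f (\<lambda>j. c j * of_real (s j)))"
    by (simp only: of_real_eq_iff)
  thus ?thesis using l2_normsq_nonneg[of M "f (\<lambda>j. c j * of_real (s j))"] by linarith
qed

text \<open>Upper half of the min-max principle. The conditions \<open>f \<bottom> u\<^sub>i\<close> are \<open>k - 1\<close> equations for the \<open>k\<close> coefficients of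
a combination of eigenfunctions for \<open>\<delta>\<^sub>1, \<dots>, \<delta>\<^sub>k\<close>, so they have a nontrivial solution.\<close>

theorem eigenvalue_le:
  assumes list: "lists_positive_eigenvalues M T \<delta>" and k: "1 \<le> k" and r: "0 \<le> r"
    and u: "\<And>i. i < k - 1 \<Longrightarrow> u i \<in> L2_functions M"
    and form: "\<And>f. f \<in> L2_functions M \<Longrightarrow> (\<And>i. i < k - 1 \<Longrightarrow> l2_inner M f (u i) = 0) \<Longrightarrow>
      Q f \<le> r * l2_normsq M f"
  shows "\<delta> k \<le> r"
proof (rule ccontr)
  assume "\<not> \<delta> k \<le> r"
  hence k_gt: "r < \<delta> k" by simp
  obtain v where v: "\<And>j. 1 \<le> j \<Longrightarrow> \<delta> j > 0 \<Longrightarrow> v j \<in> eigenspace M T (\<delta> j)"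
    and indep: "\<And>\<mu> c. \<mu> > 0 \<Longrightarrow> AE x in M. (\<Sum>j | 1 \<le> j \<and> \<delta> j = \<mu>. c j * v j x) = 0 \<Longrightarrow>
       \<forall>j. 1 \<le> j \<and> \<delta> j = \<mu> \<longrightarrow> c j = 0"
    and span: "\<And>\<mu> f. \<mu> > 0 \<Longrightarrow> f \<in> eigenspace M T \<mu> \<Longrightarrow>
       \<exists>c. AE x in M. f x = (\<Sum>j | 1 \<le> j \<and> \<delta> j = \<mu>. c j * v j x)"
    by (rule listed_eigenfunctions[OF list]) (rule that)
  let ?I = "{1..k}"
  have ge: "\<delta> k \<le> \<delta> j" if "j \<in> ?I" for j
    using list that by (auto simp: lists_positive_eigenvalues_def)
  have vI: "v j \<in> eigenspace M T (\<delta> j)" if "j \<in> ?I" for j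
    using v[of j] ge[OF that] that k_gt r by auto
  have v_L2: "v j \<in> L2_functions M" if "j \<in> ?I" for j using vI[OF that] by (simp add: eigenspace_def)
  have "\<exists>c. (\<exists>j\<in>?I. c j \<noteq> 0) \<and> (\<forall>i<k - 1. (\<Sum>j\<in>?I. c j * l2_inner M (v j) (u i)) = 0)"
    using k by (intro homogeneous_system_nontrivial) auto
  then obtain c i where i: "i \<in> ?I" "c i \<noteq> 0" and c: "\<forall>i<k - 1. (\<Sum>j\<in>?I. c j * l2_inner M (v j) (u i)) = 0"
    by blast
  define f where "f = (\<lambda>x. \<Sum>j\<in>?I. c j * v j x)"
  have f_L2: "f \<in> L2_functions M" unfolding f_def by (intro L2_sum v_L2)
  have "Q f \<le> r * l2_normsq M f"
  proof (rule form[OF f_L2])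
    fix i assume "i < k - 1"
    thus "l2_inner M f (u i) = 0"
      unfolding f_def using c u by (subst l2_inner_sum_left[OF v_L2]) auto
  qed
  moreover have "\<delta> k * l2_normsq M f \<le> Q f"
    unfolding f_def using vI ge by (intro Q_ge_on_eigenspan) auto
  ultimately have "(\<delta> k - r) * l2_normsq M f \<le> 0" by (simp add: algebra_simps)
  hence "l2_normsq M f \<le> 0" using k_gt by (simp add: mult_le_0_iff)
  hence f0: "AE x in M. f x = 0"
    using l2_normsq_nonneg[of M f] l2_normsq_eq_0_iff[OF f_L2] by simp
  \<comment> \<open>the part of \<open>f\<close> for the eigenvalue of a nonzero coefficient is orthogonal to the rest of \<open>f\<close>, so it
    vanishes together with \<open>f\<close>, against the independence inside that eigenspace\<close>
  let ?B = "{j \<in> ?I. \<delta> j = \<delta> i}"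
  define p where "p = (\<lambda>x. \<Sum>j\<in>?B. c j * v j x)"
  have p_L2: "p \<in> L2_functions M" unfolding p_def by (intro L2_sum) (use v_L2 in auto)
  have "l2_inner M p p = (\<Sum>j\<in>?B. cnj (c j) * l2_inner M p (v j))"
    by (rule l2_inner_sum_right[OF _ p_L2, of ?B v c, folded p_def]) (use v_L2 in auto)
  also have "\<dots> = (\<Sum>j\<in>?I. cnj (c j) * l2_inner M p (v j))"
  proof (rule sum.mono_neutral_left)
    show "\<forall>j\<in>?I - ?B. cnj (c j) * l2_inner M p (v j) = 0"
    proof
      fix j assume j: "j \<in> ?I - ?B"
      have "l2_inner M p (v j) = (\<Sum>l\<in>?B. c l * l2_inner M (v l) (v j))"
        unfolding p_def by (rule l2_inner_sum_left) (use v_L2 j in auto)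
      also have "\<dots> = 0"
        using eigenfunctions_orthogonal[OF vI vI] j by (intro sum.neutral) auto
      finally show "cnj (c j) * l2_inner M p (v j) = 0" by simp
    qed
  qed auto
  also have "\<dots> = l2_inner M p f"
    by (rule l2_inner_sum_right[OF _ p_L2, of ?I v c, folded f_def, symmetric]) (use v_L2 in auto)
  also have "\<dots> = cnj (l2_inner M f p)" by (simp add: l2_inner_cnj)
  also have "\<dots> = 0" using l2_inner_eq_0_if_AE_0[OF f0] by simp
  finally have p0: "AE x in M. p x = 0"
    using l2_normsq_eq_0_iff[OF p_L2] by (simp add: l2_inner_self)
  let ?d = "\<lambda>j. if j \<in> ?I then c j else 0"
  have pos: "\<delta> i > 0" using ge[OF i(1)] k_gt r by simp
  have "finite {j. 1 \<le> j \<and> \<delta> j = \<delta> i}"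
    using list pos by (auto simp: lists_positive_eigenvalues_def)
  hence "(\<Sum>j | 1 \<le> j \<and> \<delta> j = \<delta> i. ?d j * v j x) = p x" for x
    unfolding p_def by (intro sum.mono_neutral_cong_right) auto
  hence "\<forall>j. 1 \<le> j \<and> \<delta> j = \<delta> i \<longrightarrow> ?d j = 0"
    using indep[OF pos, of ?d] p0 by simp
  thus False using i by auto
qed

text \<open>Lower half of the min-max principle, for a test space of dimension \<open>n\<close> on which the form is bounded below after
\<open>m\<close> linear conditions. If \<open>\<delta>\<^sub>k < r\<close>, then fewer than \<open>k\<close> listed eigenfunctions have eigenvalue at least \<open>r\<close>.
Some \<open>f\<close> in the test space is orthogonal to these and satisfies the \<open>m\<close> conditions; it yields a new eigenvector
with eigenvalue at least \<open>r\<close>, although the list already spans all of them.\<close>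

theorem eigenvalue_ge:
  assumes list: "lists_positive_eigenvalues M T \<delta>" and k: "1 \<le> k" and r: "0 < r"
    and w: "\<And>i. i < n \<Longrightarrow> w i \<in> L2_functions M"
    and indep: "\<And>c. AE x in M. (\<Sum>i<n. c i * w i x) = 0 \<Longrightarrow> (\<And>i. i < n \<Longrightarrow> c i = 0)"
    and u: "\<And>i. i < m \<Longrightarrow> u i \<in> L2_functions M" and mn: "k + m \<le> n"
    and form: "\<And>c. (\<And>i. i < m \<Longrightarrow> l2_inner M (\<lambda>x. \<Sum>i<n. c i * w i x) (u i) = 0) \<Longrightarrow>
      r * l2_normsq M (\<lambda>x. \<Sum>i<n. c i * w i x) \<le> Q (\<lambda>x. \<Sum>i<n. c i * w i x)"
  shows "r \<le> \<delta> k"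
proof (rule ccontr)
  assume "\<not> r \<le> \<delta> k"
  hence k_lt: "\<delta> k < r" by simp
  obtain v where v: "\<And>j. 1 \<le> j \<Longrightarrow> \<delta> j > 0 \<Longrightarrow> v j \<in> eigenspace M T (\<delta> j)"
    and indep_v: "\<And>\<mu> c. \<mu> > 0 \<Longrightarrow> AE x in M. (\<Sum>j | 1 \<le> j \<and> \<delta> j = \<mu>. c j * v j x) = 0 \<Longrightarrow>
       \<forall>j. 1 \<le> j \<and> \<delta> j = \<mu> \<longrightarrow> c j = 0"
    and span: "\<And>\<mu> f. \<mu> > 0 \<Longrightarrow> f \<in> eigenspace M T \<mu> \<Longrightarrow>
       \<exists>c. AE x in M. f x = (\<Sum>j | 1 \<le> j \<and> \<delta> j = \<mu>. c j * v j x)"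
    by (rule listed_eigenfunctions[OF list]) (rule that)
  define U where "U = v ` {j. 1 \<le> j \<and> r \<le> \<delta> j}"
  have big: "j < k" if "r \<le> \<delta> j" "1 \<le> j" for j
    using list k that k_lt unfolding lists_positive_eigenvalues_def by (meson le_less_trans not_less)
  have v_eig: "v j \<in> eigenspace M T (\<delta> j)" if "1 \<le> j" "r \<le> \<delta> j" for j
    using v[of j] that r by simp
  have v_L2: "v j \<in> L2_functions M" if "1 \<le> j" "r \<le> \<delta> j" for j
    using v_eig[OF that] by (simp add: eigenspace_def)
  \<comment> \<open>equation \<open>m + i\<close> stands for the eigenfunction with index \<open>i + 1\<close>; it is void if its eigenvalue is below
    \<open>r\<close>\<close>
  define A where "A l i = (if l < m then l2_inner M (w i) (u l)
      else if r \<le> \<delta> (l - m + 1) then l2_inner M (w i) (v (l - m + 1)) else 0)" for l i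
  have "\<exists>c. (\<exists>i\<in>{..<n}. c i \<noteq> 0) \<and> (\<forall>l<m + (k - 1). (\<Sum>i<n. c i * A l i) = 0)"
    using mn k by (intro homogeneous_system_nontrivial) auto
  then obtain c p where p: "p < n" "c p \<noteq> 0" and c: "\<And>l. l < m + (k - 1) \<Longrightarrow> (\<Sum>i<n. c i * A l i) = 0"
    by blast
  define f where "f = (\<lambda>x. \<Sum>i<n. c i * w i x)"
  have f_L2: "f \<in> L2_functions M" unfolding f_def by (intro L2_sum w) auto
  have f_inner: "l2_inner M f h = (\<Sum>i<n. c i * l2_inner M (w i) h)" if "h \<in> L2_functions M" for h
    unfolding f_def by (rule l2_inner_sum_left[OF w that]) auto
  have f_u: "l2_inner M f (u l) = 0" if "l < m" for l
    using c[of l] that by (simp add: f_inner u A_def)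
  have "l2_inner M f (v j) = 0" if "1 \<le> j" "r \<le> \<delta> j" for j
  proof -
    obtain i where i: "j = Suc i" using \<open>1 \<le> j\<close> by (cases j) auto
    have "A (m + i) l = l2_inner M (w l) (v j)" for l using that by (simp add: A_def i)
    thus ?thesis using c[of "m + i"] big[OF that(2,1)] i f_inner[OF v_L2[OF that]] by simp
  qed
  hence f_U: "l2_inner M f h = 0" if "h \<in> U" for h using that by (auto simp: U_def)
  have "\<not> (AE x in M. f x = 0)" using indep[of c p] p by (auto simp: f_def)
  hence f_pos: "l2_normsq M f > 0"
    using l2_normsq_eq_0_iff[OF f_L2] l2_normsq_nonneg[of M f] by linarith
  have f_form: "r * l2_normsq M f \<le> Q f" unfolding f_def by (rule form) (use f_u in \<open>simp add: f_def\<close>)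
  have U_L2: "h \<in> L2_functions M" if "h \<in> U" for h using that v_L2 by (auto simp: U_def)
  have U_eig: "\<exists>l. AE x in M. T h x = l * h x" if "h \<in> U" for h
    using that v_eig by (fastforce simp: U_def eigenspace_def)
  obtain h \<mu> where h: "h \<in> L2_functions M" "\<And>u. u \<in> U \<Longrightarrow> l2_inner M h u = 0"
      "l2_normsq M h > 0" "\<mu> \<ge> r" "\<And>x. T h x = of_real \<mu> * h x"
    by (rule exists_eigenvector_orthogonal[of U, OF U_L2 U_eig f_L2 f_U f_pos r f_form]) (assumption+, rule that)
  have "h \<in> eigenspace M T \<mu>" using h by (simp add: eigenspace_def)
  then obtain d where d: "AE x in M. h x = (\<Sum>j | 1 \<le> j \<and> \<delta> j = \<mu>. d j * v j x)"
    using span[of \<mu> h] h(4) r by auto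
  define s where "s = (\<lambda>x. \<Sum>j | 1 \<le> j \<and> \<delta> j = \<mu>. d j * v j x)"
  have s_L2: "s \<in> L2_functions M" unfolding s_def by (intro L2_sum v_L2) (use h(4) in auto)
  have "l2_inner M h h = l2_inner M h s"
    using d L2_functionsD(1)[OF h(1)] L2_functionsD(1)[OF s_L2]
    by (intro l2_inner_cong_AE) (auto simp: s_def)
  also have "\<dots> = (\<Sum>j | 1 \<le> j \<and> \<delta> j = \<mu>. cnj (d j) * l2_inner M h (v j))"
    unfolding s_def by (rule l2_inner_sum_right[OF v_L2 h(1)]) (use h(4) in auto)
  also have "\<dots> = 0" using h(2,4) by (intro sum.neutral) (auto simp: U_def)
  finally show False using h(3) by (simp add: l2_inner_self)
qed

end

section \<open>Moments of the Gamma distribution\<close>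

lemma nn_integral_powr_exp:
  fixes a p :: real
  assumes a: "a > 0" and p: "p > 0"
  shows "(\<integral>\<^sup>+t. ennreal (if t > 0 then t powr (a - 1) * exp (- (p * t)) else 0) \<partial>lborel) = ennreal (Gamma a * p powr (- a))"
proof -
  let ?f = "\<lambda>t::real. ennreal (indicator {0..} t * t powr (a - 1) / exp t)"
  let ?g = "\<lambda>t::real. ennreal (if t > 0 then t powr (a - 1) * exp (- (p * t)) else 0)"
  have "ennreal (Gamma a) = (\<integral>\<^sup>+t. ?f t \<partial>lborel)"
    by (rule Gamma_conv_nn_integral_real[OF a])
  also have "\<dots> = ennreal p * (\<integral>\<^sup>+t. ?f (0 + p * t) \<partial>lborel)"
    using p by (subst nn_integral_real_affine[of _ p 0]) auto
  also have "(\<integral>\<^sup>+t. ?f (0 + p * t) \<partial>lborel) = (\<integral>\<^sup>+t. ennreal (p powr (a - 1)) * ?g t \<partial>lborel)"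
    using p by (intro nn_integral_cong)
      (auto simp: indicator_def powr_mult exp_minus field_simps zero_le_mult_iff simp flip: ennreal_mult')
  also have "\<dots> = ennreal (p powr (a - 1)) * (\<integral>\<^sup>+t. ?g t \<partial>lborel)"
    by (rule nn_integral_cmult) measurable
  also have "ennreal p * \<dots> = ennreal (p powr a) * (\<integral>\<^sup>+t. ?g t \<partial>lborel)"
    using p by (simp add: mult.assoc[symmetric] powr_diff flip: ennreal_mult')
  finally have *: "ennreal (Gamma a) = ennreal (p powr a) * (\<integral>\<^sup>+t. ?g t \<partial>lborel)" .
  have "ennreal (Gamma a * p powr (- a)) = ennreal (p powr (- a)) * ennreal (Gamma a)"
    using a by (simp add: mult.commute flip: ennreal_mult)
  also have "\<dots> = ennreal (p powr (- a) * p powr a) * (\<integral>\<^sup>+t. ?g t \<partial>lborel)"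
    unfolding * by (simp add: mult.assoc ennreal_mult')
  also have "p powr (- a) * p powr a = 1" using p by (simp add: powr_minus)
  finally show ?thesis by simp
qed

lemma sets_gamma_distr [simp, measurable_cong]: "sets (gamma_distr \<alpha>) = sets borel"
  by (simp add: gamma_distr_def)

lemma space_gamma_distr [simp]: "space (gamma_distr \<alpha>) = UNIV"
  by (simp add: gamma_distr_def)

lemma AE_gamma_distr:
  assumes "\<alpha> > 0"
  shows "(AE t in gamma_distr \<alpha>. P t) \<longleftrightarrow> (AE t in lborel. t > 0 \<longrightarrow> P t)"
proof -
  have "0 < ennreal (if t > 0 then t powr (\<alpha> - 1) * exp (- t) / Gamma \<alpha> else 0) \<longleftrightarrow> t > 0" for t
    using assms by simp
  thus ?thesis unfolding gamma_distr_def by (subst AE_density) simp_all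
qed

lemma gamma_distr_moment:
  assumes \<alpha>: "\<alpha> > 0" and q: "1 + q > 0"
  shows "has_bochner_integral (gamma_distr \<alpha>) (\<lambda>t. t ^ m * exp (- (q * t)))
    (Gamma (\<alpha> + real m) / Gamma \<alpha> * (1 + q) powr (- (\<alpha> + real m)))"
  unfolding gamma_distr_def
proof (rule has_bochner_integral_density)
  let ?d = "\<lambda>t. if t > 0 then t powr (\<alpha> - 1) * exp (- t) / Gamma \<alpha> else 0"
  let ?g = "\<lambda>t. if t > 0 then t powr (\<alpha> + real m - 1) * exp (- ((1 + q) * t)) else 0"
  have G: "Gamma \<alpha> > 0" "Gamma (\<alpha> + real m) > 0" using \<alpha> by simp_all
  have eq: "?d t *\<^sub>R (t ^ m * exp (- (q * t))) = ?g t / Gamma \<alpha>" for t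
    by (simp add: powr_add powr_diff powr_realpow exp_add[symmetric] field_simps)
  have "has_bochner_integral lborel ?g (Gamma (\<alpha> + real m) * (1 + q) powr (- (\<alpha> + real m)))"
    using nn_integral_powr_exp[of "\<alpha> + real m" "1 + q"] \<alpha> q G
    by (intro has_bochner_integral_nn_integral) auto
  from has_bochner_integral_divide_zero[OF this, of "Gamma \<alpha>"]
  show "has_bochner_integral lborel (\<lambda>t. ?d t *\<^sub>R (t ^ m * exp (- (q * t))))
      (Gamma (\<alpha> + real m) / Gamma \<alpha> * (1 + q) powr (- (\<alpha> + real m)))"
    unfolding eq by (simp add: field_simps)
qed (use assms in auto)

section \<open>Exponential polynomials\<close>

definition exp_poly :: "real \<Rightarrow> real poly \<Rightarrow> real \<Rightarrow> complex" where
  "exp_poly c P t = complex_of_real (exp (- (c * t)) * poly P t)"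

lemma exp_poly_sum_smult: "exp_poly c (\<Sum>i\<in>I. smult (d i) (P i)) t = (\<Sum>i\<in>I. complex_of_real (d i) * exp_poly c (P i) t)"
  by (simp add: exp_poly_def poly_sum sum_distrib_left mult_ac)

lemma exp_poly_monom_L2:
  assumes \<alpha>: "\<alpha> > 0" and q: "1 + 2 * c > 0"
  shows "exp_poly c (monom 1 n) \<in> L2_functions (gamma_distr \<alpha>)"
proof -
  have "(cmod (exp_poly c (monom 1 n) t))\<^sup>2 = t ^ (2 * n) * exp (- (2 * c * t))" for t
  proof -
    have "(cmod (exp_poly c (monom 1 n) t))\<^sup>2 = (exp (- (c * t)) * t ^ n)\<^sup>2"
      unfolding exp_poly_def norm_of_real power2_abs by (simp add: poly_monom)
    also have "\<dots> = t ^ (2 * n) * (exp (- (c * t)))\<^sup>2"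
      by (simp add: power_mult_distrib power_mult[symmetric] mult.commute)
    finally show ?thesis by (simp add: exp_double[symmetric] mult.assoc flip: exp_of_nat_mult)
  qed
  moreover have "integrable (gamma_distr \<alpha>) (\<lambda>t. t ^ (2 * n) * exp (- (2 * c * t)))"
    using gamma_distr_moment[OF \<alpha> q] by (rule integrable.intros)
  moreover have "exp_poly c (monom 1 n) \<in> borel_measurable borel"
    unfolding exp_poly_def poly_monom by measurable
  ultimately show ?thesis by (simp add: L2_functions_def cong: measurable_cong_sets)
qed

lemma exp_poly_L2:
  assumes "\<alpha> > 0" "1 + 2 * c > 0"
  shows "exp_poly c P \<in> L2_functions (gamma_distr \<alpha>)"
proof -
  have "exp_poly c P = (\<lambda>t. \<Sum>i\<le>degree P. complex_of_real (coeff P i) * exp_poly c (monom 1 i) t)"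
    by (subst poly_as_sum_of_monoms[of P, symmetric], subst exp_poly_sum_smult[symmetric]) (simp add: smult_monom)
  thus ?thesis using L2_sum[OF exp_poly_monom_L2[OF assms]] by simp
qed

lemma exp_poly_AE_zero:
  assumes \<alpha>: "\<alpha> > 0" and "AE t in gamma_distr \<alpha>. exp_poly c P t = 0"
  shows "P = 0"
proof (rule ccontr)
  assume "P \<noteq> 0"
  hence "finite {t. poly P t = 0}" by (rule poly_roots_finite)
  hence "AE t in lborel. t \<notin> {t. poly P t = 0}"
    by (intro AE_not_in finite_imp_null_set_lborel)
  moreover have "AE t in lborel. t > 0 \<longrightarrow> poly P t = 0"
    using assms by (simp add: AE_gamma_distr exp_poly_def)
  ultimately have "AE t in lborel. \<not> t \<in> {0<..<1::real}"
    by eventually_elim auto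
  hence "{0<..<1::real} \<in> null_sets lborel"
    by (subst AE_iff_null_sets) auto
  thus False by (simp add: null_sets_def)
qed

lemma monic_family_spans:
  fixes \<phi> :: "nat \<Rightarrow> 'a :: comm_ring_1 poly"
  assumes "\<And>i. i < n \<Longrightarrow> degree (\<phi> i) = i \<and> lead_coeff (\<phi> i) = 1"
    and "\<And>k. n \<le> k \<Longrightarrow> coeff q k = 0"
  shows "\<exists>d. q = (\<Sum>i<n. smult (d i) (\<phi> i))"
  using assms
proof (induction n arbitrary: q)
  case 0
  thus ?case by (auto simp: poly_eq_iff)
next
  case (Suc n)
  let ?r = "q - smult (coeff q n) (\<phi> n)"
  have "coeff ?r k = 0" if "n \<le> k" for k
  proof (cases "k = n")
    case True
    have "coeff (\<phi> n) n = 1" using Suc.prems(1)[OF lessI] by metis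
    thus ?thesis using True by simp
  next
    case False
    hence "n < k" using that by simp
    hence "coeff (\<phi> n) k = 0" using Suc.prems(1)[OF lessI] by (intro coeff_eq_0) metis
    thus ?thesis using Suc.prems(2)[of k] \<open>n < k\<close> by simp
  qed
  then obtain d where d: "?r = (\<Sum>i<n. smult (d i) (\<phi> i))"
    using Suc.IH[of ?r] Suc.prems(1) less_SucI by blast
  have "q = (\<Sum>i<Suc n. smult ((d(n := coeff q n)) i) (\<phi> i))"
    using d by (simp add: algebra_simps)
  thus ?case by blast
qed

section \<open>Two hypergeometric series\<close>

text \<open>Since \<open>(z)\<^bsub>n+1\<^esub> = z (z+1)\<^sub>n\<close> and \<open>z = a + j\<close>, the sum for \<open>n + 1\<close> at \<open>a\<close> is \<open>a\<close> times the sum for \<open>n\<close> at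
\<open>a + 1\<close> plus, after a shift of \<open>j\<close>, \<open>x\<close> times the sum for \<open>n\<close> at \<open>a + 2\<close>; the second part raises
the degree.\<close>

lemma exp_pochhammer_sums:
  fixes a :: real
  shows "\<exists>R. degree R = n \<and> lead_coeff R = 1 \<and>
    (\<forall>x. (\<lambda>j. x ^ j / fact j * pochhammer (a + real j) n) sums (exp x * poly R x))"
proof (induction n arbitrary: a)
  case 0
  show ?case
  proof (intro exI[of _ 1] conjI allI)
    show "(\<lambda>j. x ^ j / fact j * pochhammer (a + real j) 0) sums (exp x * poly 1 x)" for x
      using exp_converges[of x] by (simp add: scaleR_conv_of_real field_simps)
  qed simp_all
next
  case (Suc n)
  obtain R1 where R1: "degree R1 = n" "lead_coeff R1 = 1"
      "\<And>x. (\<lambda>j. x ^ j / fact j * pochhammer (a + 1 + real j) n) sums (exp x * poly R1 x)"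
    using Suc.IH[of "a + 1"] by blast
  obtain R2 where R2: "degree R2 = n" "lead_coeff R2 = 1"
      "\<And>x. (\<lambda>j. x ^ j / fact j * pochhammer (a + 2 + real j) n) sums (exp x * poly R2 x)"
    using Suc.IH[of "a + 2"] by blast
  define R where "R = smult a R1 + pCons 0 R2"
  have n: "coeff R (Suc n) = 1"
    using R1 R2 by (simp add: R_def coeff_eq_0)
  have "degree R \<le> Suc n"
    unfolding R_def using R1(1) R2(1) by (intro degree_add_le) (auto intro: order_trans[OF degree_smult_le] order_trans[OF degree_pCons_le])
  hence deg: "degree R = Suc n" using le_degree[of R "Suc n"] n by simp
  have "(\<lambda>j. x ^ j / fact j * pochhammer (a + real j) (Suc n)) sums (exp x * poly R x)" for x
  proof -
    have "(\<lambda>j. x * (x ^ j / fact j * pochhammer (a + 2 + real j) n)) sums (x * (exp x * poly R2 x))"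
      by (rule sums_mult[OF R2(3)])
    also have "(\<lambda>j. x * (x ^ j / fact j * pochhammer (a + 2 + real j) n)) =
        (\<lambda>j. real (Suc j) * (x ^ Suc j / fact (Suc j) * pochhammer (a + 1 + real (Suc j)) n))"
      by (rule ext) (simp add: field_simps del: of_nat_Suc, simp add: algebra_simps)
    finally have "(\<lambda>j. real j * (x ^ j / fact j * pochhammer (a + 1 + real j) n)) sums (x * (exp x * poly R2 x))"
      by (subst (asm) sums_Suc_iff) simp
    from sums_add[OF sums_mult[OF R1(3), of a] this]
    have "(\<lambda>j. a * (x ^ j / fact j * pochhammer (a + 1 + real j) n) +
        real j * (x ^ j / fact j * pochhammer (a + 1 + real j) n)) sums (a * (exp x * poly R1 x) + x * (exp x * poly R2 x))" .
    moreover have "a * (x ^ j / fact j * pochhammer (a + 1 + real j) n) +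
        real j * (x ^ j / fact j * pochhammer (a + 1 + real j) n) =
        x ^ j / fact j * pochhammer (a + real j) (Suc n)" for j
      by (simp add: pochhammer_rec algebra_simps)
    ultimately show ?thesis by (simp add: R_def algebra_simps)
  qed
  thus ?case using deg n by (intro exI[of _ R]) simp
qed

lemma summable_bessel_series:
  fixes \<alpha> y :: real
  assumes \<alpha>: "\<alpha> > 0"
  shows "summable (\<lambda>j. y ^ j / (fact j * Gamma (\<alpha> + real j)))"
proof (rule summable_ratio_test[of "1/2" "nat \<lceil>2 * \<bar>y\<bar> / \<alpha>\<rceil>"])
  fix j assume "nat \<lceil>2 * \<bar>y\<bar> / \<alpha>\<rceil> \<le> j"
  hence "2 * \<bar>y\<bar> / \<alpha> \<le> real j" by linarith
  hence "2 * \<bar>y\<bar> \<le> real j * \<alpha>" using \<alpha> by (simp add: field_simps)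
  also have "\<dots> \<le> (real j + 1) * (\<alpha> + real j)" using \<alpha> by (intro mult_mono) auto
  finally have le: "\<bar>y\<bar> / ((real j + 1) * (\<alpha> + real j)) \<le> 1 / 2"
    using \<alpha> by (subst pos_divide_le_eq) auto
  have G: "Gamma (\<alpha> + real j) > 0" using \<alpha> by simp
  have "Gamma (\<alpha> + real (Suc j)) = (\<alpha> + real j) * Gamma (\<alpha> + real j)"
    using Gamma_plus1[of "\<alpha> + real j"] \<alpha> by (simp add: add_ac nonpos_Ints_def)
  hence "norm (y ^ Suc j / (fact (Suc j) * Gamma (\<alpha> + real (Suc j))))
      = \<bar>y\<bar> / ((real j + 1) * (\<alpha> + real j)) * norm (y ^ j / (fact j * Gamma (\<alpha> + real j)))"
    using \<alpha> G by (simp add: abs_mult power_abs field_simps)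
  also have "\<dots> \<le> 1 / 2 * norm (y ^ j / (fact j * Gamma (\<alpha> + real j)))"
    using le by (rule mult_right_mono) simp
  finally show "norm (y ^ Suc j / (fact (Suc j) * Gamma (\<alpha> + real (Suc j))))
      \<le> 1 / 2 * norm (y ^ j / (fact j * Gamma (\<alpha> + real j)))" .
qed simp

lemma bessel_factor_sums:
  assumes \<alpha>: "\<alpha> > 0" and x: "x > 0"
  shows "(\<lambda>j. x ^ j / (fact j * Gamma (\<alpha> + real j))) sums bessel_factor \<alpha> x"
proof -
  have "x powr ((1 - \<alpha>) / 2) * (1 / (fact j * Gamma (\<alpha> - 1 + 1 + real j)) * (2 * sqrt x / 2) powr (2 * real j + (\<alpha> - 1)))
      = x ^ j / (fact j * Gamma (\<alpha> + real j))" for j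
  proof -
    have "(2 * sqrt x / 2) powr (2 * real j + (\<alpha> - 1)) = x powr (real j + (\<alpha> - 1) / 2)"
      using x by (simp add: powr_half_sqrt[symmetric] powr_powr field_simps)
    moreover have "x powr ((1 - \<alpha>) / 2) * x powr (real j + (\<alpha> - 1) / 2) = x ^ j"
      using x by (simp add: powr_add[symmetric] powr_realpow[symmetric] field_simps)
    ultimately show ?thesis by simp
  qed
  note coefficient = this
  have "x powr ((1 - \<alpha>) / 2) \<noteq> 0" using x by simp
  hence "summable (\<lambda>j. 1 / (fact j * Gamma (\<alpha> - 1 + 1 + real j)) * (2 * sqrt x / 2) powr (2 * real j + (\<alpha> - 1)))"
    using summable_bessel_series[OF \<alpha>, of x] unfolding coefficient[symmetric] by (simp only: summable_cmult_iff simp_thms)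
  hence "(\<lambda>j. x powr ((1 - \<alpha>) / 2) * (1 / (fact j * Gamma (\<alpha> - 1 + 1 + real j)) * (2 * sqrt x / 2) powr (2 * real j + (\<alpha> - 1))))
      sums (x powr ((1 - \<alpha>) / 2) * bessel_I (\<alpha> - 1) (2 * sqrt x))"
    unfolding bessel_I_def by (intro sums_mult summable_sums)
  thus ?thesis unfolding coefficient using x by (simp add: bessel_factor_def)
qed

section \<open>The features of the kernel\<close>

definition feature :: "real \<Rightarrow> nat \<Rightarrow> real \<Rightarrow> complex" where
  "feature \<alpha> j s = complex_of_real
     (sqrt (Gamma \<alpha> / (fact j * Gamma (\<alpha> + real j))) * (s / \<alpha>) ^ j * exp (- (s / \<alpha>)))"

lemma feature_eq_exp_poly:
  "feature \<alpha> j = (\<lambda>s. complex_of_real (sqrt (Gamma \<alpha> / (fact j * Gamma (\<alpha> + real j))) / \<alpha> ^ j) *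
     exp_poly (1 / \<alpha>) (monom 1 j) s)"
  by (simp add: feature_def exp_poly_def poly_monom power_divide fun_eq_iff)

lemma feature_product:
  assumes "\<alpha> > 0"
  shows "feature \<alpha> j s * cnj (feature \<alpha> j t) =
    complex_of_real (exp (- (s + t) / \<alpha>) * (Gamma \<alpha> * ((s * t / \<alpha>\<^sup>2) ^ j / (fact j * Gamma (\<alpha> + real j)))))"
proof -
  define r where "r = Gamma \<alpha> / (fact j * Gamma (\<alpha> + real j))"
  have r: "sqrt r * sqrt r = r" using assms by (simp add: r_def)
  have "(sqrt r * (s / \<alpha>) ^ j * exp (- (s / \<alpha>))) * (sqrt r * (t / \<alpha>) ^ j * exp (- (t / \<alpha>))) =
      (sqrt r * sqrt r) * ((s / \<alpha>) ^ j * (t / \<alpha>) ^ j) * (exp (- (s / \<alpha>)) * exp (- (t / \<alpha>)))"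
    by (simp only: mult_ac)
  also note r
  also have "(s / \<alpha>) ^ j * (t / \<alpha>) ^ j = (s * t / \<alpha>\<^sup>2) ^ j"
    unfolding power_mult_distrib[symmetric] by (simp add: power2_eq_square)
  also have "exp (- (s / \<alpha>)) * exp (- (t / \<alpha>)) = exp (- (s + t) / \<alpha>)"
    unfolding mult_exp_exp by (simp add: add_divide_distrib diff_divide_distrib)
  finally show ?thesis
    unfolding feature_def complex_cnj_complex_of_real of_real_mult[symmetric]
    by (simp add: r_def mult_ac)
qed

lemma feature_normsq:
  assumes \<alpha>: "\<alpha> > 0"
  shows "l2_normsq (gamma_distr \<alpha>) (feature \<alpha> j) =
    Gamma (\<alpha> + real (2 * j)) / (fact j * Gamma (\<alpha> + real j)) / \<alpha> ^ (2 * j) *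
      (1 + 2 / \<alpha>) powr (- (\<alpha> + real (2 * j)))"
proof -
  let ?r = "Gamma \<alpha> / (fact j * Gamma (\<alpha> + real j))"
  have r: "?r \<ge> 0" using \<alpha> by simp
  have "(cmod (feature \<alpha> j t))\<^sup>2 = ?r / \<alpha> ^ (2 * j) * (t ^ (2 * j) * exp (- (2 / \<alpha> * t)))" for t
  proof -
    have "(cmod (feature \<alpha> j t))\<^sup>2 = (sqrt ?r * (t / \<alpha>) ^ j * exp (- (t / \<alpha>)))\<^sup>2"
      unfolding feature_def norm_of_real power2_abs ..
    also have "\<dots> = ?r * ((t / \<alpha>) ^ j)\<^sup>2 * (exp (- (t / \<alpha>)))\<^sup>2"
      using r by (simp add: power_mult_distrib)
    also have "((t / \<alpha>) ^ j)\<^sup>2 = t ^ (2 * j) / \<alpha> ^ (2 * j)"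
      by (simp add: power_mult[symmetric] power_divide mult.commute)
    also have "(exp (- (t / \<alpha>)))\<^sup>2 = exp (- (2 / \<alpha> * t))"
      by (simp add: exp_double[symmetric])
    finally show ?thesis by (simp add: field_simps)
  qed
  hence "l2_normsq (gamma_distr \<alpha>) (feature \<alpha> j) =
      ?r / \<alpha> ^ (2 * j) * (LINT t|gamma_distr \<alpha>. t ^ (2 * j) * exp (- (2 / \<alpha> * t)))"
    by (simp add: l2_normsq_def)
  also have "(LINT t|gamma_distr \<alpha>. t ^ (2 * j) * exp (- (2 / \<alpha> * t))) =
      Gamma (\<alpha> + real (2 * j)) / Gamma \<alpha> * (1 + 2 / \<alpha>) powr (- (\<alpha> + real (2 * j)))"
    using \<alpha> by (intro has_bochner_integral_integral_eq gamma_distr_moment) (auto simp: add_pos_pos)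
  also have "?r / \<alpha> ^ (2 * j) * \<dots> = Gamma (\<alpha> + real (2 * j)) / (fact j * Gamma (\<alpha> + real j)) / \<alpha> ^ (2 * j) *
      (1 + 2 / \<alpha>) powr (- (\<alpha> + real (2 * j)))"
    using Gamma_real_pos[OF \<alpha>] by simp
  finally show ?thesis .
qed

text \<open>The quotient of successive squared norms is
\<open>(\<alpha>+2j+1)(\<alpha>+2j) / ((j+1)(\<alpha>+j)(\<alpha>+2)\<^sup>2)\<close>, which is at most \<open>2/(\<alpha>+2)\<close> because
\<open>\<alpha>+2j+1 \<le> (\<alpha>+2)(j+1)\<close> and \<open>\<alpha>+2j \<le> 2(\<alpha>+j)\<close>.\<close>

lemma summable_feature_normsq:
  assumes \<alpha>: "\<alpha> > 0"
  shows "summable (\<lambda>j. l2_normsq (gamma_distr \<alpha>) (feature \<alpha> j))"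
proof (rule summable_ratio_test[of "2 / (\<alpha> + 2)" 0])
  show "2 / (\<alpha> + 2) < 1" using \<alpha> by simp
  fix j :: nat
  let ?N = "\<lambda>j. l2_normsq (gamma_distr \<alpha>) (feature \<alpha> j)"
  let ?x = "\<alpha> + real (2 * j)"
  have G: "Gamma (\<alpha> + real (2 * Suc j)) = (?x + 1) * ?x * Gamma ?x"
    "Gamma (\<alpha> + real (Suc j)) = (\<alpha> + real j) * Gamma (\<alpha> + real j)"
    using Gamma_plus1[of "?x + 1"] Gamma_plus1[of ?x] Gamma_plus1[of "\<alpha> + real j"] \<alpha>
    by (auto simp: add_ac nonpos_Ints_def)
  have P: "(1 + 2 / \<alpha>) powr (- (\<alpha> + real (2 * Suc j))) = (1 + 2 / \<alpha>) powr (- ?x) / (1 + 2 / \<alpha>)\<^sup>2"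
  proof -
    have "- (\<alpha> + real (2 * Suc j)) = - ?x - real 2" by simp
    thus ?thesis using \<alpha> by (simp only: powr_diff powr_realpow[of "1 + 2 / \<alpha>" 2] add_pos_pos zero_less_one divide_pos_pos zero_less_numeral)
  qed
  have "\<alpha>\<^sup>2 * (1 + 2 / \<alpha>)\<^sup>2 = (\<alpha> * (1 + 2 / \<alpha>))\<^sup>2" by (simp add: power_mult_distrib)
  also have "\<alpha> * (1 + 2 / \<alpha>) = \<alpha> + 2" using \<alpha> by (simp add: field_simps)
  finally have sq: "\<alpha>\<^sup>2 * (1 + 2 / \<alpha>)\<^sup>2 = (\<alpha> + 2)\<^sup>2" .
  have "?N (Suc j) = ?N j * (((?x + 1) * ?x) / ((real j + 1) * (\<alpha> + real j) * (\<alpha>\<^sup>2 * (1 + 2 / \<alpha>)\<^sup>2)))"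
    unfolding feature_normsq[OF \<alpha>] G P by (simp add: power_add power2_eq_square mult_ac add_ac)
  also have "\<dots> \<le> ?N j * (2 / (\<alpha> + 2))"
  proof (rule mult_left_mono[OF _ l2_normsq_nonneg])
    have "(?x + 1) * ?x \<le> ((\<alpha> + 2) * (real j + 1)) * (2 * (\<alpha> + real j))"
      using \<alpha> by (intro mult_mono) (auto simp: algebra_simps)
    also have "\<dots> = 2 / (\<alpha> + 2) * ((real j + 1) * (\<alpha> + real j) * (\<alpha> + 2)\<^sup>2)"
      using \<alpha> by (simp add: power2_eq_square)
    finally show "((?x + 1) * ?x) / ((real j + 1) * (\<alpha> + real j) * (\<alpha>\<^sup>2 * (1 + 2 / \<alpha>)\<^sup>2)) \<le> 2 / (\<alpha> + 2)"
      unfolding sq using \<alpha> by (subst pos_divide_le_eq) auto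
  qed
  finally show "norm (?N (Suc j)) \<le> 2 / (\<alpha> + 2) * norm (?N j)"
    by (simp only: real_norm_def abs_of_nonneg[OF l2_normsq_nonneg] mult.commute)
qed

lemma summable_feature_pointwise:
  assumes \<alpha>: "\<alpha> > 0"
  shows "summable (\<lambda>j. (cmod (feature \<alpha> j s))\<^sup>2)"
proof -
  have "(cmod (feature \<alpha> j s))\<^sup>2 =
      exp (- (s + s) / \<alpha>) * Gamma \<alpha> * ((s * s / \<alpha>\<^sup>2) ^ j / (fact j * Gamma (\<alpha> + real j)))" for j
    using feature_product[OF \<alpha>, of j s s]
    by (simp only: complex_norm_square[symmetric] of_real_power[symmetric] of_real_eq_iff mult.assoc)
  thus ?thesis using summable_mult[OF summable_bessel_series[OF \<alpha>]] by simp
qed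

text \<open>The features with \<open>j = 0\<close> and \<open>j = 1\<close> contribute \<open>1\<close> and \<open>s t / \<alpha>\<^sup>3\<close> in the bracket of the kernel, since
\<open>\<Gamma>(\<alpha>+1) = \<alpha> \<Gamma>(\<alpha>)\<close>.\<close>

lemma kernel_K_sums:
  assumes \<alpha>: "\<alpha> > 0" and st: "s > 0" "t > 0"
  shows "(\<lambda>j. feature \<alpha> (j + 2) s * cnj (feature \<alpha> (j + 2) t)) sums complex_of_real (kernel_K \<alpha> s t)"
proof -
  let ?x = "s * t / \<alpha>\<^sup>2"
  let ?a = "\<lambda>j. Gamma \<alpha> * (?x ^ j / (fact j * Gamma (\<alpha> + real j)))"
  have G: "Gamma \<alpha> > 0" "Gamma (\<alpha> + 1) = \<alpha> * Gamma \<alpha>"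
    using \<alpha> Gamma_plus1[of \<alpha>] by (auto simp: nonpos_Ints_def)
  have "?a sums (Gamma \<alpha> * bessel_factor \<alpha> ?x)"
    using st \<alpha> by (intro sums_mult bessel_factor_sums) auto
  hence "(\<lambda>j. ?a (j + 2)) sums (Gamma \<alpha> * bessel_factor \<alpha> ?x - (\<Sum>j<2. ?a j))"
    by (rule sums_split_initial_segment)
  also have "(\<Sum>j<2. ?a j) = s * t / \<alpha> ^ 3 + 1"
    using G(1)[THEN less_imp_neq] G(2) \<alpha> by (simp add: numeral_2_eq_2 numeral_3_eq_3 field_simps)
  finally have "(\<lambda>j. exp (- (s + t) / \<alpha>) * ?a (j + 2)) sums kernel_K \<alpha> s t"
    unfolding kernel_K_def diff_diff_eq by (rule sums_mult)
  thus ?thesis unfolding feature_product[OF \<alpha>] by (rule sums_of_real)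
qed

lemma kernel_K_measurable: "(\<lambda>t. kernel_K \<alpha> s t) \<in> borel_measurable borel"
  unfolding kernel_K_def bessel_factor_def bessel_I_def by measurable

section \<open>The decay rate\<close>

locale laguerre_kernel =
  fixes \<alpha> :: real
  assumes \<alpha>_ge: "\<alpha> \<ge> 1 / 2"
begin

text \<open>The exponent of the eigenfunctions, the positive root of \<open>c\<^sup>2 + c = 1/\<alpha>\<close>.\<close>

definition c :: real where "c = (beta_of \<alpha> - 1) / 2"

text \<open>The total decay rate in the integral of \<open>e\<^bsup>-ct\<^esup> t\<^sup>n\<close> against a feature: \<open>e\<^bsup>-t\<^esup>\<close> comes from the distribution
and \<open>e\<^bsup>-t/\<alpha>\<^esup>\<close> from the feature.\<close>

definition p :: real where "p = 1 + c + 1 / \<alpha>"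

lemma \<alpha>_pos: "\<alpha> > 0" using \<alpha>_ge by simp

lemma c_pos: "c > 0"
  using \<alpha>_pos by (simp add: c_def beta_of_def)

lemma c_quadratic: "c\<^sup>2 + c = 1 / \<alpha>"
proof -
  have "(beta_of \<alpha>)\<^sup>2 = (\<alpha> + 4) / \<alpha>" using \<alpha>_pos by (simp add: beta_of_def)
  also have "\<dots> = 1 + 4 / \<alpha>" using \<alpha>_pos by (simp add: field_simps)
  finally show ?thesis by (simp add: c_def power2_eq_square field_simps)
qed

lemma c_lt: "c < 1 / \<alpha>"
proof -
  have "0 < c\<^sup>2" using c_pos by simp
  thus ?thesis using c_quadratic by linarith
qed

lemma p_pos: "p > 0" using c_pos \<alpha>_pos by (simp add: p_def add_pos_pos)

lemma inverse_p: "1 / p = \<alpha> * (1 - \<alpha> * c)"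
proof -
  have "\<alpha> * (c\<^sup>2 + c) = 1" using \<alpha>_pos c_quadratic by simp
  hence q: "\<alpha> * c\<^sup>2 = 1 - \<alpha> * c" by (simp add: algebra_simps)
  have "p * (\<alpha> * (1 - \<alpha> * c)) = (\<alpha> + \<alpha> * c + 1) * (1 - \<alpha> * c)"
    using \<alpha>_pos by (simp add: p_def field_simps)
  also have "\<dots> = \<alpha> + 1 - \<alpha> * (\<alpha> * c) - \<alpha> * (\<alpha> * c\<^sup>2)"
    by (simp add: algebra_simps power2_eq_square)
  also have "\<dots> = 1" unfolding q by (simp add: algebra_simps)
  finally show ?thesis using p_pos by (simp add: field_simps)
qed

lemma b_squared: "(b_of \<alpha>)\<^sup>2 = 1 - \<alpha> * c" and b_pos: "b_of \<alpha> > 0" and b_lt_1: "b_of \<alpha> < 1"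
proof -
  have eq: "1 + \<alpha> * (1 - beta_of \<alpha>) / 2 = 1 - \<alpha> * c" by (simp add: c_def field_simps)
  have ac: "0 < \<alpha> * c" "\<alpha> * c < 1" using c_pos c_lt \<alpha>_pos by (auto simp: field_simps)
  show "(b_of \<alpha>)\<^sup>2 = 1 - \<alpha> * c" "b_of \<alpha> > 0" "b_of \<alpha> < 1"
    unfolding b_of_def eq using ac by auto
qed

text \<open>The full operator maps \<open>e\<^bsup>-ct\<^esup>\<close> to a multiple of \<open>e\<^bsup>-(1/\<alpha> - 1/(\<alpha>\<^sup>2 p))s\<^esup>\<close>, so this equation says that the exponent \<open>c\<close> is
preserved.\<close>

lemma fixed_exponent: "1 / (\<alpha>\<^sup>2 * p) = 1 / \<alpha> - c"
proof -
  have "1 / (\<alpha>\<^sup>2 * p) = 1 / \<alpha>\<^sup>2 * (1 / p)" by simp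
  also have "\<dots> = 1 / \<alpha> - c" unfolding inverse_p using \<alpha>_pos by (simp add: field_simps power2_eq_square)
  finally show ?thesis .
qed

text \<open>The form in which \<open>\<rho>\<^sub>n\<close> arises as a leading coefficient; it rests on \<open>1/p = \<alpha> b\<^sub>\<alpha>\<^sup>2\<close>.\<close>

lemma rho_eq: "rho \<alpha> n = p powr (- (\<alpha> + real n)) * (1 / (\<alpha>\<^sup>2 * p)) ^ n"
proof -
  let ?b = "b_of \<alpha>"
  have p: "1 / p = \<alpha> * ?b\<^sup>2" by (simp add: inverse_p b_squared)
  have d: "1 / (\<alpha>\<^sup>2 * p) = ?b\<^sup>2 / \<alpha>"
    using p \<alpha>_pos p_pos by (simp add: field_simps power2_eq_square)
  have B: "?b\<^sup>2 powr \<alpha> = ?b powr (2 * \<alpha>)"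
    using b_pos by (simp add: powr_powr flip: powr_numeral)
  have "p powr (- (\<alpha> + real n)) = (1 / p) powr (\<alpha> + real n)"
    unfolding powr_minus_divide using p_pos by (simp add: powr_divide)
  also have "\<dots> = \<alpha> powr \<alpha> * \<alpha> ^ n * (?b powr (2 * \<alpha>) * ?b ^ (2 * n))"
    unfolding p using \<alpha>_pos b_pos
    by (simp add: powr_mult powr_add powr_realpow B mult_ac flip: power_mult)
  finally have "p powr (- (\<alpha> + real n)) * (1 / (\<alpha>\<^sup>2 * p)) ^ n =
      \<alpha> powr \<alpha> * (?b powr (2 * \<alpha>) * ?b ^ (2 * n) * ?b ^ (2 * n))"
    unfolding d using \<alpha>_pos by (simp add: power_divide flip: power_mult)
  also have "?b powr (2 * \<alpha>) * ?b ^ (2 * n) * ?b ^ (2 * n) = ?b powr (4 * real n + 2 * \<alpha>)"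
    using b_pos by (simp add: powr_realpow[symmetric] powr_add[symmetric])
  finally show ?thesis by (simp add: rho_def)
qed

lemma rho_pos: "rho \<alpha> n > 0"
  using b_pos \<alpha>_pos by (simp add: rho_def)

lemma rho_strict_anti: "i < j \<Longrightarrow> rho \<alpha> j < rho \<alpha> i"
  unfolding rho_def using b_pos b_lt_1 \<alpha>_pos
  by (intro mult_strict_left_mono powr_less_mono') auto

text \<open>Here \<open>\<alpha> \<ge> 1/2\<close> enters. With \<open>d = 1/\<alpha> - c\<close>, the inequality says that \<open>e\<^bsup>-(c-d)t\<^esup>\<close> is square-integrable. As
\<open>2c + 1 = \<surd>(1 + 4/\<alpha>)\<close>, it is equivalent to \<open>(1/2 + 1/\<alpha>)\<^sup>2 < 1 + 4/\<alpha>\<close>, which holds for \<open>1/\<alpha> \<le> 2\<close>.\<close>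

lemma c_large: "1 + 2 * (2 * c - 1 / \<alpha>) > 0"
proof -
  define u where "u = 1 / \<alpha>"
  have u: "0 < u" "u \<le> 2" using \<alpha>_ge by (auto simp: u_def field_simps)
  have "(1 / 2 + u)\<^sup>2 < 1 + 4 * u"
  proof -
    have "0 < u * (3 - u)" using u by (intro mult_pos_pos) auto
    moreover have "(1 / 2 + u)\<^sup>2 = 1 / 4 + u + u * u"
      unfolding power2_sum by (simp add: power2_eq_square)
    moreover have "u * (3 - u) = 3 * u - u * u" by (simp only: right_diff_distrib mult.commute)
    ultimately show ?thesis by linarith
  qed
  also have "1 + 4 * u = (2 * c + 1)\<^sup>2"
  proof -
    have "(2 * c + 1)\<^sup>2 = 4 * (c\<^sup>2 + c) + 1" by (simp add: power2_eq_square algebra_simps)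
    thus ?thesis unfolding c_quadratic u_def by simp
  qed
  finally have "1 / 2 + u < 2 * c + 1"
    by (rule power2_less_imp_less) (use c_pos in simp)
  hence "0 < 2 * ((2 * c + 1) - (1 / 2 + u))" by simp
  also have "\<dots> = 1 + 2 * (2 * c - u)" by (simp add: algebra_simps)
  finally show ?thesis unfolding u_def .
qed

end

section \<open>The truncated kernel inside the full one\<close>

lemma suminf_split_first_two:
  fixes f :: "nat \<Rightarrow> real"
  assumes "summable f"
  shows "(\<Sum>j. f j) = (\<Sum>j. f (j + 2)) + f 0 + f 1"
  using suminf_split_initial_segment[OF assms, of 2] by (simp add: numeral_2_eq_2)

context laguerre_kernel
begin

abbreviation P0 :: "real measure" where "P0 \<equiv> gamma_distr \<alpha>"

sublocale full: summable_features P0 "feature \<alpha>"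
proof
  show "feature \<alpha> j \<in> L2_functions P0" for j
    unfolding feature_eq_exp_poly using \<alpha>_pos by (intro L2_scale exp_poly_L2) (auto simp: add_pos_pos)
qed (use summable_feature_normsq summable_feature_pointwise \<alpha>_pos in auto)

definition tail_feature :: "nat \<Rightarrow> real \<Rightarrow> complex" where
  "tail_feature j = feature \<alpha> (j + 2)"

sublocale trunc: summable_features P0 tail_feature
  unfolding tail_feature_def
proof
  show "feature \<alpha> (j + 2) \<in> L2_functions P0" for j by (rule full.feature_L2)
  show "summable (\<lambda>j. l2_normsq P0 (feature \<alpha> (j + 2)))"
    using full.summable_trace by (rule summable_ignore_initial_segment)
  show "summable (\<lambda>j. (cmod (feature \<alpha> (j + 2) x))\<^sup>2)" for x
    using full.summable_pointwise by (rule summable_ignore_initial_segment)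
qed

lemma trunc_coef: "trunc.coef f j = full.coef f (j + 2)"
  by (simp add: trunc.coef_def full.coef_def tail_feature_def)

lemma full_Q_eq:
  assumes "f \<in> L2_functions P0"
  shows "full.Q f = trunc.Q f + (cmod (full.coef f 0))\<^sup>2 + (cmod (full.coef f 1))\<^sup>2"
  unfolding full.Q_def trunc.Q_def trunc_coef
  by (rule suminf_split_first_two[OF full.summable_coef[OF assms]])

lemma operator_S_eq_trunc:
  assumes "f \<in> L2_functions P0"
  shows "AE s in P0. operator_S \<alpha> f s = trunc.T f s"
proof -
  have "operator_S \<alpha> f s = trunc.T f s" if "s > 0" for s
    unfolding operator_S_def
  proof (rule trunc.integral_operator_eq_T[OF assms])
    show "AE t in P0. complex_of_real (kernel_K \<alpha> s t) = (\<Sum>j. tail_feature j s * cnj (tail_feature j t))"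
      unfolding tail_feature_def AE_gamma_distr[OF \<alpha>_pos]
      using kernel_K_sums[OF \<alpha>_pos that] by (intro AE_I2) (auto simp: sums_iff)
    show "(\<lambda>t. kernel_K \<alpha> s t) \<in> borel_measurable P0"
      using kernel_K_measurable by (simp cong: measurable_cong_sets)
  qed
  thus ?thesis unfolding AE_gamma_distr[OF \<alpha>_pos] by (intro AE_I2) simp
qed

lemma eigenspace_operator_S: "eigenspace P0 (operator_S \<alpha>) \<mu> = eigenspace P0 trunc.T \<mu>"
proof -
  have "(AE s in P0. operator_S \<alpha> f s = complex_of_real \<mu> * f s) \<longleftrightarrow>
      (AE s in P0. trunc.T f s = complex_of_real \<mu> * f s)" if "f \<in> L2_functions P0" for f
    using operator_S_eq_trunc[OF that] by (intro eventually_cong) auto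
  thus ?thesis unfolding eigenspace_def by blast
qed

section \<open>Diagonalisation of the full kernel\<close>

abbreviation E :: "real poly \<Rightarrow> real \<Rightarrow> complex" where "E \<equiv> exp_poly c"

lemma E_L2: "E q \<in> L2_functions P0"
  using c_pos \<alpha>_pos by (intro exp_poly_L2) auto

lemma coef_E_monom:
  "full.coef (E (monom 1 n)) j = complex_of_real
     (sqrt (Gamma \<alpha> / (fact j * Gamma (\<alpha> + real j))) / \<alpha> ^ j *
      (Gamma (\<alpha> + real (n + j)) / Gamma \<alpha> * p powr (- (\<alpha> + real (n + j)))))"
proof -
  have "E (monom 1 n) t * cnj (exp_poly (1 / \<alpha>) (monom 1 j) t) =
      complex_of_real (t ^ (n + j) * exp (- ((c + 1 / \<alpha>) * t)))" for t
    unfolding exp_poly_def complex_cnj_complex_of_real of_real_mult[symmetric] of_real_eq_iff poly_monom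
    by (simp add: power_add distrib_right exp_diff exp_minus field_simps exp_add)
  hence "l2_inner P0 (E (monom 1 n)) (exp_poly (1 / \<alpha>) (monom 1 j)) =
      of_real (LINT t|P0. t ^ (n + j) * exp (- ((c + 1 / \<alpha>) * t)))"
    unfolding l2_inner_def by (simp only: integral_complex_of_real)
  also have "(LINT t|P0. t ^ (n + j) * exp (- ((c + 1 / \<alpha>) * t))) =
      Gamma (\<alpha> + real (n + j)) / Gamma \<alpha> * (1 + (c + 1 / \<alpha>)) powr (- (\<alpha> + real (n + j)))"
    using \<alpha>_pos c_pos by (intro has_bochner_integral_integral_eq gamma_distr_moment) (auto simp: add_pos_pos)
  also have "1 + (c + 1 / \<alpha>) = p" by (simp add: p_def)
  finally show ?thesis
    unfolding full.coef_def feature_eq_exp_poly l2_inner_scale_right complex_cnj_complex_of_real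
    by (simp only: of_real_mult)
qed

text \<open>In the series for \<open>T\<close> the quotients \<open>\<Gamma>(\<alpha>+j+n) / \<Gamma>(\<alpha>+j)\<close> are Pochhammer symbols, so \<open>exp_pochhammer_sums\<close>
sums it to \<open>e\<^bsup>ys\<^esup> R(ys)\<close> with \<open>y = 1/(\<alpha>\<^sup>2 p)\<close>, where \<open>R\<close> is monic of degree \<open>n\<close>; \<open>fixed_exponent\<close> combines the
exponentials.\<close>

lemma T_E_monom:
  obtains q where "coeff q n = rho \<alpha> n" "\<And>k. n < k \<Longrightarrow> coeff q k = 0" "full.T (E (monom 1 n)) = E q"
proof -
  obtain R where R: "degree R = n" "lead_coeff R = 1"
      "\<And>x. (\<lambda>j. x ^ j / fact j * pochhammer (\<alpha> + real j) n) sums (exp x * poly R x)"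
    using exp_pochhammer_sums[of n \<alpha>] by blast
  define y where "y = 1 / (\<alpha>\<^sup>2 * p)"
  define k where "k = p powr (- (\<alpha> + real n))"
  define q where "q = smult k (R \<circ>\<^sub>p [:0, y:])"
  have y: "y \<noteq> 0" using \<alpha>_pos p_pos by (simp add: y_def)
  have coeff_q: "coeff q i = k * (coeff R i * y ^ i)" for i
    by (simp add: q_def coeff_pcompose_linear)
  have "coeff q n = rho \<alpha> n" using R by (simp add: coeff_q rho_eq k_def y_def)
  moreover have "coeff q i = 0" if "n < i" for i using R that by (simp add: coeff_q coeff_eq_0)
  moreover have "full.T (E (monom 1 n)) s = E q s" for s
  proof -
    have summand: "full.coef (E (monom 1 n)) j * feature \<alpha> j s = complex_of_real
        (exp (- (s / \<alpha>)) * k * ((y * s) ^ j / fact j * pochhammer (\<alpha> + real j) n))" for j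
    proof -
      let ?r = "Gamma \<alpha> / (fact j * Gamma (\<alpha> + real j))"
      have sq: "sqrt ?r * sqrt ?r = ?r" using \<alpha>_pos by simp
      have G: "Gamma \<alpha> > 0" "Gamma (\<alpha> + real j) > 0" using \<alpha>_pos by simp_all
      have "Gamma (\<alpha> + real (n + j)) = pochhammer (\<alpha> + real j) n * Gamma (\<alpha> + real j)"
      proof -
        have "\<alpha> + real j \<notin> \<int>\<^sub>\<le>\<^sub>0" using \<alpha>_pos by (auto simp: nonpos_Ints_def)
        thus ?thesis using G(2)[THEN less_imp_neq] by (simp add: pochhammer_Gamma add_ac)
      qed
      moreover have "p powr (- (\<alpha> + real (n + j))) = k / p ^ j"
      proof -
        have "- (\<alpha> + real (n + j)) = - (\<alpha> + real n) - real j" by simp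
        thus ?thesis using p_pos by (simp only: powr_diff powr_realpow k_def)
      qed
      moreover have "y ^ j = 1 / (\<alpha> ^ j * \<alpha> ^ j * p ^ j)"
        by (simp add: y_def power2_eq_square power_mult_distrib power_divide)
      ultimately have "sqrt ?r / \<alpha> ^ j * (Gamma (\<alpha> + real (n + j)) / Gamma \<alpha> * p powr (- (\<alpha> + real (n + j)))) *
          (sqrt ?r * (s / \<alpha>) ^ j * exp (- (s / \<alpha>))) =
          (sqrt ?r * sqrt ?r) * (exp (- (s / \<alpha>)) * k * (y ^ j * s ^ j * (pochhammer (\<alpha> + real j) n * Gamma (\<alpha> + real j) / Gamma \<alpha>)))"
        by (simp add: power_divide mult_ac)
      also have "\<dots> = exp (- (s / \<alpha>)) * k * ((y * s) ^ j / fact j * pochhammer (\<alpha> + real j) n)"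
        unfolding sq using G by (simp add: power_mult_distrib)
      finally show ?thesis unfolding coef_E_monom feature_def of_real_mult[symmetric] by simp
    qed
    have "(\<lambda>j. exp (- (s / \<alpha>)) * k * ((y * s) ^ j / fact j * pochhammer (\<alpha> + real j) n)) sums
        (exp (- (s / \<alpha>)) * k * (exp (y * s) * poly R (y * s)))"
      by (intro sums_mult R(3))
    hence "(\<lambda>j. full.coef (E (monom 1 n)) j * feature \<alpha> j s) sums
        complex_of_real (exp (- (s / \<alpha>)) * k * (exp (y * s) * poly R (y * s)))"
      unfolding summand by (rule sums_of_real)
    hence "full.T (E (monom 1 n)) s = complex_of_real (exp (- (s / \<alpha>)) * k * (exp (y * s) * poly R (y * s)))"
      by (simp add: full.T_def full.synth_def sums_iff)
    moreover have "exp (- (s / \<alpha>)) * exp (y * s) = exp (- (c * s))"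
      unfolding mult_exp_exp y_def fixed_exponent by (simp add: algebra_simps)
    hence "exp (- (s / \<alpha>)) * k * (exp (y * s) * poly R (y * s)) = exp (- (c * s)) * (k * poly R (y * s))"
      by (metis mult.assoc mult.left_commute)
    moreover have "poly q s = k * poly R (y * s)"
      by (simp add: q_def poly_pcompose mult.commute)
    ultimately show ?thesis by (simp only: exp_poly_def)
  qed
  ultimately show ?thesis using that by blast
qed

text \<open>\<open>T\<close> is triangular in the monomials with pairwise distinct diagonal entries \<open>\<rho>\<^sub>n\<close>. If \<open>d\<^sub>i\<close> are the coordinates
of the lower order part of the image of the \<open>n\<close>-th monomial in the earlier eigenpolynomials, then adding the
multiples \<open>d\<^sub>i / (\<rho>\<^sub>n - \<rho>\<^sub>i)\<close> of these to the monomial makes it an eigenpolynomial.\<close>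

lemma exists_laguerre_eigenpolynomial:
  "\<exists>\<phi>. degree \<phi> = n \<and> lead_coeff \<phi> = 1 \<and> full.T (E \<phi>) = (\<lambda>s. complex_of_real (rho \<alpha> n) * E \<phi> s)"
proof (induction n rule: less_induct)
  case (less n)
  define good where "good i \<phi> \<longleftrightarrow> degree \<phi> = i \<and> lead_coeff \<phi> = 1 \<and>
    full.T (E \<phi>) = (\<lambda>s. complex_of_real (rho \<alpha> i) * E \<phi> s)" for i \<phi>
  have "\<forall>i. \<exists>\<phi>. i < n \<longrightarrow> good i \<phi>" using less unfolding good_def by blast
  from choice[OF this] obtain \<phi> where \<phi>: "\<And>i. i < n \<Longrightarrow> good i (\<phi> i)" by blast
  obtain q where q: "coeff q n = rho \<alpha> n" "\<And>k. n < k \<Longrightarrow> coeff q k = 0" "full.T (E (monom 1 n)) = E q"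
    by (rule T_E_monom[of n]) (rule that)
  have "coeff (q - monom (rho \<alpha> n) n) k = 0" if "n \<le> k" for k
    using q(1) q(2)[of k] that by (cases "k = n") auto
  hence "\<exists>d. q - monom (rho \<alpha> n) n = (\<Sum>i<n. smult (d i) (\<phi> i))"
    using \<phi> unfolding good_def by (intro monic_family_spans) blast+
  then obtain d where d: "q - monom (rho \<alpha> n) n = (\<Sum>i<n. smult (d i) (\<phi> i))" by blast
  define e where "e i = d i / (rho \<alpha> n - rho \<alpha> i)" for i
  define \<psi> where "\<psi> = monom 1 n + (\<Sum>i<n. smult (e i) (\<phi> i))"
  have e: "d i + e i * rho \<alpha> i = rho \<alpha> n * e i" if "i < n" for i
    using rho_strict_anti[OF that] by (simp add: e_def field_simps)
  have low: "coeff (\<Sum>i<n. smult (e i) (\<phi> i)) k = 0" if "n \<le> k" for k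
    unfolding coeff_sum using \<phi> that by (intro sum.neutral) (auto simp: good_def coeff_eq_0)
  have lead: "coeff \<psi> n = 1" using low[of n] by (simp add: \<psi>_def)
  have "degree \<psi> \<le> n" by (rule degree_le) (auto simp: \<psi>_def low)
  hence deg: "degree \<psi> = n" using le_degree[of \<psi> n] lead by simp
  have E_q: "E q s = complex_of_real (rho \<alpha> n) * E (monom 1 n) s + (\<Sum>i<n. complex_of_real (d i) * E (\<phi> i) s)" for s
  proof -
    have "q = monom (rho \<alpha> n) n + (\<Sum>i<n. smult (d i) (\<phi> i))" using d by (simp add: algebra_simps)
    hence "E q s = E (monom (rho \<alpha> n) n) s + E (\<Sum>i<n. smult (d i) (\<phi> i)) s"
      by (simp add: exp_poly_def distrib_left)
    thus ?thesis by (simp add: exp_poly_sum_smult) (simp add: exp_poly_def poly_monom)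
  qed
  have E_\<psi>: "E \<psi> = (\<lambda>s. E (monom 1 n) s - (\<Sum>i<n. complex_of_real (- e i) * E (\<phi> i) s))"
  proof
    fix s
    have "E \<psi> s = E (monom 1 n) s + E (\<Sum>i<n. smult (e i) (\<phi> i)) s"
      by (simp add: \<psi>_def exp_poly_def distrib_left)
    thus "E \<psi> s = E (monom 1 n) s - (\<Sum>i<n. complex_of_real (- e i) * E (\<phi> i) s)"
      by (simp add: exp_poly_sum_smult sum_negf)
  qed
  have "full.T (E \<psi>) s = complex_of_real (rho \<alpha> n) * E \<psi> s" for s
  proof -
    have "full.T (E \<psi>) s = E q s - (\<Sum>i<n. complex_of_real (- e i) * full.T (E (\<phi> i)) s)"
      unfolding E_\<psi> by (subst full.T_diff) (auto simp only: full.T_sum[OF _ E_L2] q(3) E_L2 L2_sum finite_lessThan)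
    also have "(\<Sum>i<n. complex_of_real (- e i) * full.T (E (\<phi> i)) s) =
        (\<Sum>i<n. complex_of_real (- e i) * (complex_of_real (rho \<alpha> i) * E (\<phi> i) s))"
      using \<phi> by (intro sum.cong refl) (simp add: good_def)
    also have "E q s - \<dots> = complex_of_real (rho \<alpha> n) * E (monom 1 n) s +
        (\<Sum>i<n. complex_of_real (d i + e i * rho \<alpha> i) * E (\<phi> i) s)"
      unfolding E_q by (simp add: sum_negf sum.distrib algebra_simps)
    also have "(\<Sum>i<n. complex_of_real (d i + e i * rho \<alpha> i) * E (\<phi> i) s) =
        (\<Sum>i<n. complex_of_real (rho \<alpha> n * e i) * E (\<phi> i) s)"
      using e by (intro sum.cong refl) simp
    also have "complex_of_real (rho \<alpha> n) * E (monom 1 n) s + \<dots> = complex_of_real (rho \<alpha> n) * E \<psi> s"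
      unfolding E_\<psi> by (simp add: sum_negf sum_distrib_left algebra_simps)
    finally show ?thesis .
  qed
  thus ?case using deg lead by (intro exI[of _ \<psi>]) auto
qed

text \<open>Up to a factor this is the Laguerre polynomial \<open>L\<^sub>n\<close> with parameter \<open>\<alpha> - 1\<close> at \<open>(1 + 2c)x\<close>: the orthogonality below
is with respect to the weight \<open>x\<^bsup>\<alpha>-1\<^esup> e\<^bsup>-(1+2c)x\<^esup>\<close>.\<close>

definition laguerre :: "nat \<Rightarrow> real poly" where
  "laguerre n = (SOME \<phi>. degree \<phi> = n \<and> lead_coeff \<phi> = 1 \<and>
     full.T (E \<phi>) = (\<lambda>s. complex_of_real (rho \<alpha> n) * E \<phi> s))"

lemma degree_laguerre: "degree (laguerre n) = n"
  and lead_coeff_laguerre: "lead_coeff (laguerre n) = 1"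
  and T_laguerre: "full.T (E (laguerre n)) = (\<lambda>s. complex_of_real (rho \<alpha> n) * E (laguerre n) s)"
  using someI_ex[OF exists_laguerre_eigenpolynomial[of n]] unfolding laguerre_def by blast+

lemma laguerre_eigenfunction: "E (laguerre n) \<in> eigenspace P0 full.T (rho \<alpha> n)"
  by (simp add: eigenspace_def E_L2 T_laguerre)

lemma laguerre_orthogonal:
  assumes "i \<noteq> j"
  shows "l2_inner P0 (E (laguerre i)) (E (laguerre j)) = 0"
proof (rule full.eigenfunctions_orthogonal[OF laguerre_eigenfunction laguerre_eigenfunction])
  show "rho \<alpha> i \<noteq> rho \<alpha> j"
    using assms rho_strict_anti[of i j] rho_strict_anti[of j i] by (cases "i < j") auto
qed

lemma laguerre_normsq_pos: "l2_normsq P0 (E (laguerre n)) > 0"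
proof -
  have "laguerre n \<noteq> 0" using lead_coeff_laguerre[of n] by auto
  hence "\<not> (AE t in P0. E (laguerre n) t = 0)" using exp_poly_AE_zero[OF \<alpha>_pos] by blast
  thus ?thesis using l2_normsq_eq_0_iff[OF E_L2] l2_normsq_nonneg[of P0 "E (laguerre n)"] by (metis less_eq_real_def)
qed

lemma laguerre_independent:
  assumes "AE t in P0. (\<Sum>i<n. a i * E (laguerre i) t) = 0" and j: "j < n"
  shows "a j = 0"
proof -
  have "0 = l2_inner P0 (\<lambda>t. \<Sum>i<n. a i * E (laguerre i) t) (E (laguerre j))"
    by (rule l2_inner_eq_0_if_AE_0[OF assms(1), symmetric])
  also have "\<dots> = (\<Sum>i<n. a i * l2_inner P0 (E (laguerre i)) (E (laguerre j)))"
    by (rule l2_inner_sum_left) (rule E_L2)+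
  also have "\<dots> = a j * l2_inner P0 (E (laguerre j)) (E (laguerre j))"
    using j laguerre_orthogonal by (subst sum.remove[of _ j]) (auto intro!: sum.neutral)
  finally show ?thesis using laguerre_normsq_pos[of j] by (simp add: l2_inner_self)
qed

text \<open>Completeness. Up to a factor the feature is \<open>e\<^bsup>-ct\<^esup> t\<^sup>j e\<^bsup>-dt\<^esup>\<close> with \<open>d = 1/\<alpha> - c > 0\<close>, the limit of exponential
polynomials obtained from the Taylor sums of \<open>e\<^bsup>-dt\<^esup>\<close>. They are all dominated by \<open>e\<^bsup>-ct\<^esup> t\<^sup>j e\<^bsup>dt\<^esup>\<close>, which is
square-integrable by \<open>c_large\<close>.\<close>

lemma orthogonal_exp_poly_imp_orthogonal_feature:
  assumes h: "h \<in> L2_functions P0" and orth: "\<And>q. l2_inner P0 h (E q) = 0"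
  shows "l2_inner P0 h (feature \<alpha> j) = 0"
proof -
  define d where "d = 1 / \<alpha> - c"
  have d: "d > 0" using c_lt by (simp add: d_def)
  define q where "q N = (\<Sum>i<N. monom ((- d) ^ i / fact i) (i + j))" for N
  define w where "w = exp_poly (c - d) (monom 1 j)"
  have w_L2: "w \<in> L2_functions P0"
    unfolding w_def using \<alpha>_pos c_large by (intro exp_poly_L2) (auto simp: d_def algebra_simps)
  have poly_q: "poly (q N) t = t ^ j * (\<Sum>i<N. (- (d * t)) ^ i / fact i)" for N t
  proof -
    have "(- (d * t)) ^ i = (- d) ^ i * t ^ i" for i by (simp flip: power_mult_distrib)
    thus ?thesis by (simp add: q_def poly_sum poly_monom sum_distrib_left power_add mult_ac)
  qed
  have lim: "(\<lambda>N. E (q N) t) \<longlonglongrightarrow> exp_poly (1 / \<alpha>) (monom 1 j) t" for t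
  proof -
    have "(\<lambda>N. \<Sum>i<N. (- (d * t)) ^ i / fact i) \<longlonglongrightarrow> exp (- (d * t))"
      using exp_converges[of "- (d * t)"] by (simp add: sums_def scaleR_conv_of_real field_simps)
    hence "(\<lambda>N. complex_of_real (exp (- (c * t)) * (t ^ j * (\<Sum>i<N. (- (d * t)) ^ i / fact i)))) \<longlonglongrightarrow>
        complex_of_real (exp (- (c * t)) * (t ^ j * exp (- (d * t))))"
      by (intro tendsto_intros)
    moreover have "exp (- (c * t)) * (t ^ j * exp (- (d * t))) = exp (- (1 / \<alpha> * t)) * t ^ j"
    proof -
      have "exp (- (c * t)) * exp (- (d * t)) = exp (- (1 / \<alpha> * t))"
        unfolding mult_exp_exp by (simp add: d_def algebra_simps)
      thus ?thesis by (metis mult.assoc mult.commute)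
    qed
    ultimately show ?thesis unfolding exp_poly_def poly_q by (simp add: poly_monom)
  qed
  have bound: "cmod (E (q N) t) \<le> cmod (w t)" if "t > 0" for N t
  proof -
    have "\<bar>\<Sum>i<N. (- (d * t)) ^ i / fact i\<bar> \<le> (\<Sum>i<N. (d * t) ^ i / fact i)"
      using d that by (intro order_trans[OF sum_abs] sum_mono) (simp add: abs_mult power_abs)
    also have "\<dots> \<le> exp (d * t)"
      using d that sum_le_suminf[of "\<lambda>i. (d * t) ^ i / fact i" "{..<N}"] exp_converges[of "d * t"]
      by (simp add: sums_iff scaleR_conv_of_real field_simps)
    finally have "\<bar>\<Sum>i<N. (- (d * t)) ^ i / fact i\<bar> \<le> exp (d * t)" .
    hence "exp (- (c * t)) * (t ^ j * \<bar>\<Sum>i<N. (- (d * t)) ^ i / fact i\<bar>) \<le> exp (- (c * t)) * (t ^ j * exp (d * t))"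
      using that by (intro mult_left_mono) auto
    also have "\<dots> = exp (- ((c - d) * t)) * t ^ j"
    proof -
      have "exp (- (c * t)) * exp (d * t) = exp (- ((c - d) * t))"
        unfolding mult_exp_exp by (simp add: algebra_simps)
      thus ?thesis by (metis mult.assoc mult.commute)
    qed
    finally show ?thesis
      using that unfolding exp_poly_def poly_q w_def norm_of_real by (simp add: abs_mult poly_monom)
  qed
  note [measurable] = L2_functionsD(1)[OF h] L2_functionsD(1)[OF E_L2]
  have m: "exp_poly (1 / \<alpha>) (monom 1 j) \<in> borel_measurable P0"
    using \<alpha>_pos by (intro L2_functionsD(1)[OF exp_poly_L2]) (auto simp: add_pos_pos)
  note [measurable] = m
  have "(\<lambda>N. l2_inner P0 h (E (q N))) \<longlonglongrightarrow> l2_inner P0 h (exp_poly (1 / \<alpha>) (monom 1 j))"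
    unfolding l2_inner_def
  proof (rule integral_dominated_convergence[where w = "\<lambda>t. cmod (h t * cnj (w t))"])
    show "integrable P0 (\<lambda>t. cmod (h t * cnj (w t)))"
      by (intro integrable_norm L2_inner_integrable h w_L2)
    show "AE t in P0. (\<lambda>N. h t * cnj (E (q N) t)) \<longlonglongrightarrow> h t * cnj (exp_poly (1 / \<alpha>) (monom 1 j) t)"
      by (intro AE_I2 tendsto_intros lim)
    show "AE t in P0. norm (h t * cnj (E (q N) t)) \<le> cmod (h t * cnj (w t))" for N
      unfolding AE_gamma_distr[OF \<alpha>_pos]
      using bound by (intro AE_I2) (auto simp: norm_mult intro!: mult_left_mono)
  qed measurable
  hence "l2_inner P0 h (exp_poly (1 / \<alpha>) (monom 1 j)) = 0"
    unfolding orth by (rule LIMSEQ_unique[OF _ tendsto_const])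
  thus ?thesis unfolding feature_eq_exp_poly l2_inner_scale_right by simp
qed

text \<open>Otherwise \<open>T\<close> would have an eigenvector with eigenvalue above \<open>\<rho>\<^sub>m\<close> that is orthogonal to the first \<open>m\<close>
eigenpolynomials by construction and to the others because their eigenvalues are smaller. Completeness makes
all its coefficients vanish.\<close>

lemma full_Q_le:
  assumes f: "f \<in> L2_functions P0" and orth: "\<And>i. i < m \<Longrightarrow> l2_inner P0 f (E (laguerre i)) = 0"
  shows "full.Q f \<le> rho \<alpha> m * l2_normsq P0 f"
proof (rule ccontr)
  assume neg: "\<not> full.Q f \<le> rho \<alpha> m * l2_normsq P0 f"
  have "l2_normsq P0 f \<noteq> 0"
    using neg full.Q_le_trace[OF f] by auto
  hence pos: "l2_normsq P0 f > 0" using l2_normsq_nonneg[of P0 f] by simp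
  define r where "r = full.Q f / l2_normsq P0 f"
  have r: "rho \<alpha> m < r" "r * l2_normsq P0 f \<le> full.Q f"
    using neg pos by (auto simp: r_def field_simps)
  hence r_pos: "r > 0" using rho_pos[of m] by linarith
  let ?U = "(\<lambda>i. E (laguerre i)) ` {..<m}"
  have U_L2: "u \<in> L2_functions P0" if "u \<in> ?U" for u using that E_L2 by auto
  have U_eig: "\<exists>l. AE x in P0. full.T u x = l * u x" if "u \<in> ?U" for u
    using that by (auto simp: T_laguerre)
  have U_orth: "l2_inner P0 f u = 0" if "u \<in> ?U" for u using that orth by auto
  obtain h \<mu> where h: "h \<in> L2_functions P0" "\<And>u. u \<in> ?U \<Longrightarrow> l2_inner P0 h u = 0"
      "l2_normsq P0 h > 0" "\<mu> \<ge> r" "\<And>x. full.T h x = complex_of_real \<mu> * h x"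
    by (rule full.exists_eigenvector_orthogonal[of ?U, OF U_L2 U_eig f U_orth pos r_pos r(2)])
       (assumption+, rule that)
  have h_lag: "l2_inner P0 h (E (laguerre i)) = 0" for i
  proof (cases "i < m")
    case True
    thus ?thesis using h(2) by auto
  next
    case False
    hence "rho \<alpha> i \<le> rho \<alpha> m" using rho_strict_anti[of m i] by (cases "i = m") auto
    hence "\<mu> \<noteq> rho \<alpha> i" using h(4) r(1) by simp
    moreover have "h \<in> eigenspace P0 full.T \<mu>" using h by (simp add: eigenspace_def)
    ultimately show ?thesis by (intro full.eigenfunctions_orthogonal[OF _ laguerre_eigenfunction])
  qed
  have "l2_inner P0 h (E q) = 0" for q
  proof -
    have "\<exists>d. q = (\<Sum>i<Suc (degree q). smult (d i) (laguerre i))"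
      by (intro monic_family_spans) (auto simp: degree_laguerre lead_coeff_laguerre[unfolded degree_laguerre] coeff_eq_0)
    then obtain d where "q = (\<Sum>i<Suc (degree q). smult (d i) (laguerre i))" by blast
    hence "E q = (\<lambda>t. \<Sum>i<Suc (degree q). complex_of_real (d i) * E (laguerre i) t)"
      using exp_poly_sum_smult by metis
    hence "l2_inner P0 h (E q) = (\<Sum>i<Suc (degree q). cnj (complex_of_real (d i)) * l2_inner P0 h (E (laguerre i)))"
      by (simp only: l2_inner_sum_right[OF E_L2 h(1)])
    thus ?thesis by (simp add: h_lag)
  qed
  hence "full.coef h j = 0" for j
    unfolding full.coef_def by (intro orthogonal_exp_poly_imp_orthogonal_feature h(1))
  hence "full.T h x = 0" for x by (simp add: full.T_def full.synth_def)
  hence "h x = 0" for x using h(4) h(5)[of x] r_pos by auto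
  thus False using h(3) by (simp add: l2_normsq_def)
qed

section \<open>Interlacing\<close>

text \<open>On functions orthogonal to the first two features the forms of the truncated and the full operator coincide; this
costs two dimensions in the lower bound. In the upper bound the truncated form is just dominated by the full one.\<close>

lemma eigenvalue_S_bounds:
  assumes "lists_positive_eigenvalues P0 (operator_S \<alpha>) \<delta>" and k: "k \<ge> 1"
  shows "\<delta> k \<le> rho \<alpha> (k - 1)" and "rho \<alpha> (k + 1) \<le> \<delta> k"
proof -
  have list: "lists_positive_eigenvalues P0 trunc.T \<delta>"
    using assms(1) by (simp add: lists_positive_eigenvalues_def eigenspace_operator_S)
  show "\<delta> k \<le> rho \<alpha> (k - 1)"
  proof (rule trunc.eigenvalue_le[OF list k, where u = "\<lambda>i. E (laguerre i)"])
    fix f assume f: "f \<in> L2_functions P0" "\<And>i. i < k - 1 \<Longrightarrow> l2_inner P0 f (E (laguerre i)) = 0"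
    have "trunc.Q f \<le> full.Q f" using full_Q_eq[OF f(1)] by simp
    also have "\<dots> \<le> rho \<alpha> (k - 1) * l2_normsq P0 f" by (rule full_Q_le[OF f])
    finally show "trunc.Q f \<le> rho \<alpha> (k - 1) * l2_normsq P0 f" .
  qed (use rho_pos[of "k - 1"] E_L2 in auto)
  show "rho \<alpha> (k + 1) \<le> \<delta> k"
  proof (rule trunc.eigenvalue_ge[OF list k rho_pos, where n = "k + 2" and w = "\<lambda>i. E (laguerre i)"
        and m = 2 and u = "feature \<alpha>"])
    fix a assume orth: "\<And>i. i < 2 \<Longrightarrow> l2_inner P0 (\<lambda>t. \<Sum>i<k + 2. a i * E (laguerre i) t) (feature \<alpha> i) = 0"
    let ?f = "\<lambda>t. \<Sum>i<k + 2. a i * E (laguerre i) t"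
    have "rho \<alpha> (k + 1) * l2_normsq P0 ?f \<le> full.Q ?f"
    proof (rule full.Q_ge_on_eigenspan[OF laguerre_eigenfunction])
      show "rho \<alpha> (k + 1) \<le> rho \<alpha> i" if "i \<in> {..<k + 2}" for i
        using rho_strict_anti[of i "k + 1"] that by (cases "i = k + 1") auto
    qed auto
    also have "full.Q ?f = trunc.Q ?f"
    proof -
      have orth_01: "l2_inner P0 ?f (feature \<alpha> 0) = 0" "l2_inner P0 ?f (feature \<alpha> 1) = 0"
        by (rule orth, simp)+
      have "?f \<in> L2_functions P0" by (rule L2_sum[OF E_L2])
      from full_Q_eq[OF this] show ?thesis
        unfolding full.coef_def orth_01 by simp
    qed
    finally show "rho \<alpha> (k + 1) * l2_normsq P0 ?f \<le> trunc.Q ?f" .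
  next
    fix a i assume "AE t in P0. (\<Sum>i<k + 2. a i * E (laguerre i) t) = 0" "i < k + 2"
    thus "a i = 0" by (rule laguerre_independent)
  qed (auto simp: E_L2 full.feature_L2)
qed

end

theorem proposition3p14:
  fixes \<alpha> :: real and \<delta> :: "nat \<Rightarrow> real"
  assumes "\<alpha> \<ge> 1 / 2"
    and "lists_positive_eigenvalues (gamma_distr \<alpha>) (operator_S \<alpha>) \<delta>"
  shows "(\<forall>k\<ge>1. rho \<alpha> (k - 1) \<ge> \<delta> k \<and> \<delta> k \<ge> rho \<alpha> (k + 1)) \<and>
         (\<lambda>k. \<delta> k) \<in> O(\<lambda>k. rho \<alpha> k)"
proof -
  interpret laguerre_kernel \<alpha> by standard (rule assms(1))
  have bounds: "\<delta> k \<le> rho \<alpha> (k - 1)" "rho \<alpha> (k + 1) \<le> \<delta> k" if "k \<ge> 1" for k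
    using eigenvalue_S_bounds[OF assms(2) that] by auto
  have "norm (\<delta> k) \<le> b_of \<alpha> powr (-4) * norm (rho \<alpha> k)" if "k \<ge> 1" for k
  proof -
    have "0 \<le> \<delta> k" using bounds(2)[OF that] rho_pos[of "k + 1"] by linarith
    moreover have "rho \<alpha> (k - 1) = b_of \<alpha> powr (-4) * rho \<alpha> k"
      using that by (simp add: rho_def powr_add[symmetric] algebra_simps of_nat_diff)
    ultimately show ?thesis using bounds(1)[OF that] rho_pos[of k] by simp
  qed
  hence "(\<lambda>k. \<delta> k) \<in> O(\<lambda>k. rho \<alpha> k)"
    by (intro bigoI[where c = "b_of \<alpha> powr (-4)"]) (auto simp: eventually_at_top_linorder)
  thus ?thesis using bounds by auto
qed

end
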